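(* Let $\mathsf C$ be a Markov category with conditionals. Every cospan $X_1\to Y\leftarrow X_2$ in $\mathcal S(\mathsf C)$ admits a completion to an independent pullback.
   Context: A Markov category is a symmetric monoidal category $(\mathsf C,\otimes,I)$ (coherence isomorphisms suppressed) whose unit $I$ is terminal and in which every object $X$ carries a commutative comonoid structure $\mathrm{copy}_X:X\to X\otimes X$, $\mathrm{del}_X:X\to I$ compatible with the monoidal structure ($\mathrm{copy}_{X\otimes Y}$ is $\mathrm{copy}_X\otimes\mathrm{copy}_Y$ followed by the swap of the two middle factors, $\mathrm{del}_{X\otimes Y}=\mathrm{del}_X\otimes\mathrm{del}_Y$, and the structure on $I$ is trivial). The projections $\pi_X:X\otimes Y\to X$, $\pi_Y:X\otimes Y\to Y$ are obtained by deleting the other factor. For $f:A\to X$, $g:A\to Y$ write $\langle f,g\rangle=(f\otimes g)\circ\mathrm{copy}_A$ (similarly for triples, using iterated copy). A state is a morphism $p:I\to X$. $\mathsf C$ has conditionals if for every $f:A\to X\otimes Y$ there is $f|_X:X\otimes A\to Y$ with $f=(\mathrm{id}_X\otimes f|_X)\circ(\mathrm{copy}_X\otimes \mathrm{id}_A)\circ((\pi_X f)\otimes\mathrm{id}_A)\circ\mathrm{copy}_A$. For $f,g:X\to Y$ and a state $p:I\to X$, $f=_p g$ ($p$-almost sure equality) means $\langle \mathrm{id}_X,f\rangle\circ p=\langle\mathrm{id}_X,g\rangle\circ p$; $f$ is $p$-almost surely deterministic if $\mathrm{copy}_Y\circ f=_p(f\otimes f)\circ\mathrm{copy}_X$. The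 category $\mathcal P(\mathsf C)$ of probability spaces has objects $(\Omega,p)$ with $p:I\to\Omega$ a state; morphisms $(\Omega,p)\to(\Omega',q)$ are $p$-almost sure equality classes of $f:\Omega\to\Omega'$ with $f\circ p=q$; composition is that of $\mathsf C$ on representatives. The category $\mathcal S(\mathsf C)$ of sample spaces is the wide subcategory of $\mathcal P(\mathsf C)$ of classes of $p$-almost surely deterministic morphisms. A sample space is denoted by its underlying object $\Omega$, with state $p_\Omega$. A commutative square in $\mathcal S(\mathsf C)$ consisting of $f:\Omega\to X$, $g:\Omega\to Y$, $u:X\to Z$, $v:Y\to Z$ with $d:=uf=vg$ is called independent if there exist morphisms $\phi:Z\to X$ and $\psi:Z\to Y$ in $\mathsf C$ such that $\langle f,d,g\rangle\circ p_\Omega=\langle\phi,\mathrm{id}_Z,\psi\rangle\circ p_Z$ as states $I\to X\otimes Z\otimes Y$. It is an independent pullback if it is independent and for every independent square $f':\Omega'\to X$, $g':\Omega'\to Y$ over the same cospan $(u,v)$ there is a unique morphism $h:\Omega'\to\Omega$ in $\mathcal S(\mathsf C)$ with $fh=f'$ and $gh=g'$. *)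

theory Defs
  imports Main
begin

section \<open>Categories\<close>

record ('o, 'm) cat_data =
  Obj :: "'o set"
  Arr :: "'m set"
  Dom :: "'m \<Rightarrow> 'o"
  Cod :: "'m \<Rightarrow> 'o"
  Id :: "'o \<Rightarrow> 'm"
  Comp :: "'m \<Rightarrow> 'm \<Rightarrow> 'm"  (infixr "\<cdot>\<index>" 70)

definition Hom :: "('o, 'm, 'z) cat_data_scheme \<Rightarrow> 'o \<Rightarrow> 'o \<Rightarrow> 'm set" where
  "Hom C X Y = {f \<in> Arr C. Dom C f = X \<and> Cod C f = Y}"

locale category =
  fixes C :: "('o, 'm, 'z) cat_data_scheme" (structure)
  assumes Dom_Obj: "f \<in> Arr C \<Longrightarrow> Dom C f \<in> Obj C"
    and Cod_Obj: "f \<in> Arr C \<Longrightarrow> Cod C f \<in> Obj C"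
    and Id_Hom: "X \<in> Obj C \<Longrightarrow> Id C X \<in> Hom C X X"
    and Comp_Hom: "\<lbrakk>f \<in> Hom C X Y; g \<in> Hom C Y Z\<rbrakk> \<Longrightarrow> g \<cdot> f \<in> Hom C X Z"
    and Comp_Id_left: "f \<in> Hom C X Y \<Longrightarrow> Id C Y \<cdot> f = f"
    and Comp_Id_right: "f \<in> Hom C X Y \<Longrightarrow> f \<cdot> Id C X = f"
    and Comp_assoc:
      "\<lbrakk>f \<in> Hom C W X; g \<in> Hom C X Y; h \<in> Hom C Y Z\<rbrakk> \<Longrightarrow> (h \<cdot> g) \<cdot> f = h \<cdot> (g \<cdot> f)"

definition is_inverse :: "('o, 'm, 'z) cat_data_scheme \<Rightarrow> 'm \<Rightarrow> 'm \<Rightarrow> bool" where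
  "is_inverse C f g \<longleftrightarrow> f \<in> Arr C \<and> g \<in> Hom C (Cod C f) (Dom C f) \<and>
     g \<cdot>\<^bsub>C\<^esub> f = Id C (Dom C f) \<and> f \<cdot>\<^bsub>C\<^esub> g = Id C (Cod C f)"

definition iso_arr :: "('o, 'm, 'z) cat_data_scheme \<Rightarrow> 'm \<Rightarrow> bool" where
  "iso_arr C f \<longleftrightarrow> (\<exists>g. is_inverse C f g)"

definition inv_arr :: "('o, 'm, 'z) cat_data_scheme \<Rightarrow> 'm \<Rightarrow> 'm" where
  "inv_arr C f = (THE g. is_inverse C f g)"


section \<open>Symmetric monoidal categories\<close>

text \<open>The coherence isomorphisms are kept explicit, so strictness is not assumed.\<close>

record ('o, 'm) smc_data = "('o, 'm) cat_data" +
  Unit :: "'o"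
  TensorO :: "'o \<Rightarrow> 'o \<Rightarrow> 'o"  (infixr "\<boxtimes>\<index>" 75)
  TensorM :: "'m \<Rightarrow> 'm \<Rightarrow> 'm"  (infixr "\<otimes>\<index>" 75)
  Assoc :: "'o \<Rightarrow> 'o \<Rightarrow> 'o \<Rightarrow> 'm"
  Lunit :: "'o \<Rightarrow> 'm"
  Runit :: "'o \<Rightarrow> 'm"
  Swap :: "'o \<Rightarrow> 'o \<Rightarrow> 'm"

locale symmetric_monoidal_category = category C
  for C :: "('o, 'm, 'z) smc_data_scheme" (structure) +
  assumes Unit_Obj: "Unit C \<in> Obj C"
    and TensorO_Obj: "\<lbrakk>X \<in> Obj C; Y \<in> Obj C\<rbrakk> \<Longrightarrow> X \<boxtimes> Y \<in> Obj C"
    and TensorM_Hom: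
      "\<lbrakk>f \<in> Hom C X Y; f' \<in> Hom C X' Y'\<rbrakk> \<Longrightarrow> f \<otimes> f' \<in> Hom C (X \<boxtimes> X') (Y \<boxtimes> Y')"
    and TensorM_Id: "\<lbrakk>X \<in> Obj C; Y \<in> Obj C\<rbrakk> \<Longrightarrow> Id C X \<otimes> Id C Y = Id C (X \<boxtimes> Y)"
    and TensorM_Comp:
      "\<lbrakk>f \<in> Hom C X Y; g \<in> Hom C Y Z; f' \<in> Hom C X' Y'; g' \<in> Hom C Y' Z'\<rbrakk>
        \<Longrightarrow> (g \<cdot> f) \<otimes> (g' \<cdot> f') = (g \<otimes> g') \<cdot> (f \<otimes> f')"
    and Assoc_Hom:
      "\<lbrakk>X \<in> Obj C; Y \<in> Obj C; Z \<in> Obj C\<rbrakk>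
        \<Longrightarrow> Assoc C X Y Z \<in> Hom C ((X \<boxtimes> Y) \<boxtimes> Z) (X \<boxtimes> (Y \<boxtimes> Z))"
    and Assoc_iso:
      "\<lbrakk>X \<in> Obj C; Y \<in> Obj C; Z \<in> Obj C\<rbrakk> \<Longrightarrow> iso_arr C (Assoc C X Y Z)"
    and Assoc_natural:
      "\<lbrakk>f \<in> Hom C X X'; g \<in> Hom C Y Y'; h \<in> Hom C Z Z'\<rbrakk>
        \<Longrightarrow> Assoc C X' Y' Z' \<cdot> ((f \<otimes> g) \<otimes> h) = (f \<otimes> (g \<otimes> h)) \<cdot> Assoc C X Y Z"
    and Lunit_Hom: "X \<in> Obj C \<Longrightarrow> Lunit C X \<in> Hom C (Unit C \<boxtimes> X) X"
    and Lunit_iso: "X \<in> Obj C \<Longrightarrow> iso_arr C (Lunit C X)"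
    and Lunit_natural:
      "f \<in> Hom C X Y \<Longrightarrow> Lunit C Y \<cdot> (Id C (Unit C) \<otimes> f) = f \<cdot> Lunit C X"
    and Runit_Hom: "X \<in> Obj C \<Longrightarrow> Runit C X \<in> Hom C (X \<boxtimes> Unit C) X"
    and Runit_iso: "X \<in> Obj C \<Longrightarrow> iso_arr C (Runit C X)"
    and Runit_natural:
      "f \<in> Hom C X Y \<Longrightarrow> Runit C Y \<cdot> (f \<otimes> Id C (Unit C)) = f \<cdot> Runit C X"
    and pentagon:
      "\<lbrakk>W \<in> Obj C; X \<in> Obj C; Y \<in> Obj C; Z \<in> Obj C\<rbrakk>
        \<Longrightarrow> Assoc C W X (Y \<boxtimes> Z) \<cdot> Assoc C (W \<boxtimes> X) Y Z
          = (Id C W \<otimes> Assoc C X Y Z) \<cdot> Assoc C W (X \<boxtimes> Y) Z \<cdot> (Assoc C W X Y \<otimes> Id C Z)"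
    and triangle:
      "\<lbrakk>X \<in> Obj C; Y \<in> Obj C\<rbrakk>
        \<Longrightarrow> (Id C X \<otimes> Lunit C Y) \<cdot> Assoc C X (Unit C) Y = Runit C X \<otimes> Id C Y"
    and Swap_Hom: "\<lbrakk>X \<in> Obj C; Y \<in> Obj C\<rbrakk> \<Longrightarrow> Swap C X Y \<in> Hom C (X \<boxtimes> Y) (Y \<boxtimes> X)"
    and Swap_natural:
      "\<lbrakk>f \<in> Hom C X X'; g \<in> Hom C Y Y'\<rbrakk>
        \<Longrightarrow> Swap C X' Y' \<cdot> (f \<otimes> g) = (g \<otimes> f) \<cdot> Swap C X Y"
    and Swap_Swap:
      "\<lbrakk>X \<in> Obj C; Y \<in> Obj C\<rbrakk> \<Longrightarrow> Swap C Y X \<cdot> Swap C X Y = Id C (X \<boxtimes> Y)"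
    and hexagon:
      "\<lbrakk>X \<in> Obj C; Y \<in> Obj C; Z \<in> Obj C\<rbrakk>
        \<Longrightarrow> Assoc C Y Z X \<cdot> Swap C X (Y \<boxtimes> Z) \<cdot> Assoc C X Y Z
          = (Id C Y \<otimes> Swap C X Z) \<cdot> Assoc C Y X Z \<cdot> (Swap C X Y \<otimes> Id C Z)"

text \<open>The canonical map \<open>(W \<boxtimes> X) \<boxtimes> (Y \<boxtimes> Z) \<rightarrow> (W \<boxtimes> Y) \<boxtimes> (X \<boxtimes> Z)\<close>.\<close>

definition mid_swap :: "('o, 'm, 'z) smc_data_scheme \<Rightarrow> 'o \<Rightarrow> 'o \<Rightarrow> 'o \<Rightarrow> 'o \<Rightarrow> 'm" where
  "mid_swap C W X Y Z =
     inv_arr C (Assoc C W Y (X \<boxtimes>\<^bsub>C\<^esub> Z))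
     \<cdot>\<^bsub>C\<^esub> (Id C W \<otimes>\<^bsub>C\<^esub>
          (Assoc C Y X Z \<cdot>\<^bsub>C\<^esub> (Swap C X Y \<otimes>\<^bsub>C\<^esub> Id C Z) \<cdot>\<^bsub>C\<^esub> inv_arr C (Assoc C X Y Z)))
     \<cdot>\<^bsub>C\<^esub> Assoc C W X (Y \<boxtimes>\<^bsub>C\<^esub> Z)"


section \<open>Markov categories\<close>

record ('o, 'm) markov_data = "('o, 'm) smc_data" +
  Copy :: "'o \<Rightarrow> 'm"
  Del :: "'o \<Rightarrow> 'm"

locale markov_category = symmetric_monoidal_category C
  for C :: "('o, 'm, 'z) markov_data_scheme" (structure) +
  assumes Unit_terminal: "X \<in> Obj C \<Longrightarrow> \<exists>!f. f \<in> Hom C X (Unit C)"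
    and Copy_Hom: "X \<in> Obj C \<Longrightarrow> Copy C X \<in> Hom C X (X \<boxtimes> X)"
    and Del_Hom: "X \<in> Obj C \<Longrightarrow> Del C X \<in> Hom C X (Unit C)"
    and Copy_coassoc:
      "X \<in> Obj C \<Longrightarrow> Assoc C X X X \<cdot> (Copy C X \<otimes> Id C X) \<cdot> Copy C X
          = (Id C X \<otimes> Copy C X) \<cdot> Copy C X"
    and Copy_counit_left:
      "X \<in> Obj C \<Longrightarrow> Lunit C X \<cdot> (Del C X \<otimes> Id C X) \<cdot> Copy C X = Id C X"
    and Copy_counit_right:
      "X \<in> Obj C \<Longrightarrow> Runit C X \<cdot> (Id C X \<otimes> Del C X) \<cdot> Copy C X = Id C X"
    and Copy_commutative: "X \<in> Obj C \<Longrightarrow> Swap C X X \<cdot> Copy C X = Copy C X"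
    and Copy_TensorO:
      "\<lbrakk>X \<in> Obj C; Y \<in> Obj C\<rbrakk>
        \<Longrightarrow> Copy C (X \<boxtimes> Y) = mid_swap C X X Y Y \<cdot> (Copy C X \<otimes> Copy C Y)"
    and Del_TensorO:
      "\<lbrakk>X \<in> Obj C; Y \<in> Obj C\<rbrakk>
        \<Longrightarrow> Del C (X \<boxtimes> Y) = Lunit C (Unit C) \<cdot> (Del C X \<otimes> Del C Y)"
    and Copy_Unit: "Copy C (Unit C) = inv_arr C (Lunit C (Unit C))"
    and Del_Unit: "Del C (Unit C) = Id C (Unit C)"

definition proj_left :: "('o, 'm, 'z) markov_data_scheme \<Rightarrow> 'o \<Rightarrow> 'o \<Rightarrow> 'm" where
  "proj_left C X Y = Runit C X \<cdot>\<^bsub>C\<^esub> (Id C X \<otimes>\<^bsub>C\<^esub> Del C Y)"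

definition proj_right :: "('o, 'm, 'z) markov_data_scheme \<Rightarrow> 'o \<Rightarrow> 'o \<Rightarrow> 'm" where
  "proj_right C X Y = Lunit C Y \<cdot>\<^bsub>C\<^esub> (Del C X \<otimes>\<^bsub>C\<^esub> Id C Y)"

definition pairing :: "('o, 'm, 'z) markov_data_scheme \<Rightarrow> 'm \<Rightarrow> 'm \<Rightarrow> 'm" where
  "pairing C f g = (f \<otimes>\<^bsub>C\<^esub> g) \<cdot>\<^bsub>C\<^esub> Copy C (Dom C f)"

definition tripling :: "('o, 'm, 'z) markov_data_scheme \<Rightarrow> 'm \<Rightarrow> 'm \<Rightarrow> 'm \<Rightarrow> 'm" where
  "tripling C f g h =
     (f \<otimes>\<^bsub>C\<^esub> (g \<otimes>\<^bsub>C\<^esub> h))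
     \<cdot>\<^bsub>C\<^esub> (Id C (Dom C f) \<otimes>\<^bsub>C\<^esub> Copy C (Dom C f)) \<cdot>\<^bsub>C\<^esub> Copy C (Dom C f)"

definition has_conditionals :: "('o, 'm, 'z) markov_data_scheme \<Rightarrow> bool" where
  "has_conditionals C \<longleftrightarrow>
     (\<forall>A \<in> Obj C. \<forall>X \<in> Obj C. \<forall>Y \<in> Obj C. \<forall>f \<in> Hom C A (X \<boxtimes>\<^bsub>C\<^esub> Y).
        \<exists>k \<in> Hom C (X \<boxtimes>\<^bsub>C\<^esub> A) Y.
          f = (Id C X \<otimes>\<^bsub>C\<^esub> k)
              \<cdot>\<^bsub>C\<^esub> Assoc C X X A
              \<cdot>\<^bsub>C\<^esub> (Copy C X \<otimes>\<^bsub>C\<^esub> Id C A)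
              \<cdot>\<^bsub>C\<^esub> ((proj_left C X Y \<cdot>\<^bsub>C\<^esub> f) \<otimes>\<^bsub>C\<^esub> Id C A)
              \<cdot>\<^bsub>C\<^esub> Copy C A)"

text \<open>The next two notions are used for a state \<open>p \<in> Hom C (Unit C) X\<close> and for arrows with
  domain \<open>X\<close>.\<close>

definition as_eq :: "('o, 'm, 'z) markov_data_scheme \<Rightarrow> 'm \<Rightarrow> 'm \<Rightarrow> 'm \<Rightarrow> bool" where
  "as_eq C p f g \<longleftrightarrow>
     pairing C (Id C (Cod C p)) f \<cdot>\<^bsub>C\<^esub> p = pairing C (Id C (Cod C p)) g \<cdot>\<^bsub>C\<^esub> p"

definition as_deterministic :: "('o, 'm, 'z) markov_data_scheme \<Rightarrow> 'm \<Rightarrow> 'm \<Rightarrow> bool" where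
  "as_deterministic C p f \<longleftrightarrow>
     as_eq C p (Copy C (Cod C f) \<cdot>\<^bsub>C\<^esub> f) ((f \<otimes>\<^bsub>C\<^esub> f) \<cdot>\<^bsub>C\<^esub> Copy C (Dom C f))"


section \<open>Probability spaces and sample spaces\<close>

text \<open>A probability space is a pair of an object and a state on it.  Arrows carry source and
  target besides the almost sure equality class of the underlying arrows.\<close>

datatype ('o, 'm) prob_arr =
  Prob_Arr (src: "'o \<times> 'm") (tgt: "'o \<times> 'm") (cls: "'m set")

definition as_class :: "('o, 'm, 'z) markov_data_scheme \<Rightarrow> 'm \<Rightarrow> 'm \<Rightarrow> 'm set" where
  "as_class C p f = {g \<in> Hom C (Dom C f) (Cod C f). as_eq C p f g}"

definition as_arr ::
    "('o, 'm, 'z) markov_data_scheme \<Rightarrow> 'o \<times> 'm \<Rightarrow> 'o \<times> 'm \<Rightarrow> 'm \<Rightarrow> ('o, 'm) prob_arr" where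
  "as_arr C A B f = Prob_Arr A B (as_class C (snd A) f)"

text \<open>Composition and independence below are expressed through an arbitrary representative of
  each class.  When \<open>C\<close> is a Markov category with conditionals, they do not depend on
  this choice.\<close>

definition rep :: "('o, 'm) prob_arr \<Rightarrow> 'm" where
  "rep F = (SOME f. f \<in> cls F)"

definition Prob :: "('o, 'm, 'z) markov_data_scheme \<Rightarrow> ('o \<times> 'm, ('o, 'm) prob_arr) cat_data" where
  "Prob C = \<lparr>
     Obj = {(X, p). X \<in> Obj C \<and> p \<in> Hom C (Unit C) X},
     Arr = {as_arr C (X, p) (Y, q) f | X p Y q f.
              X \<in> Obj C \<and> p \<in> Hom C (Unit C) X \<and> Y \<in> Obj C \<and> q \<in> Hom C (Unit C) Y \<and>
              f \<in> Hom C X Y \<and> f \<cdot>\<^bsub>C\<^esub> p = q},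
     Dom = src,
     Cod = tgt,
     Id = (\<lambda>A. as_arr C A A (Id C (fst A))),
     Comp = (\<lambda>G F. as_arr C (src F) (tgt G) (rep G \<cdot>\<^bsub>C\<^esub> rep F))\<rparr>"

definition Samp :: "('o, 'm, 'z) markov_data_scheme \<Rightarrow> ('o \<times> 'm, ('o, 'm) prob_arr) cat_data" where
  "Samp C = (Prob C)
     \<lparr>Arr := {F \<in> Arr (Prob C). \<exists>f \<in> cls F. as_deterministic C (snd (src F)) f}\<rparr>"


section \<open>Independent squares and independent pullbacks\<close>

definition commutative_square ::
    "('o, 'm, 'z) cat_data_scheme \<Rightarrow> 'm \<Rightarrow> 'm \<Rightarrow> 'm \<Rightarrow> 'm \<Rightarrow> bool" where
  "commutative_square C f g u v \<longleftrightarrow>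
     (\<exists>W X Y Z. f \<in> Hom C W X \<and> g \<in> Hom C W Y \<and> u \<in> Hom C X Z \<and> v \<in> Hom C Y Z \<and>
        u \<cdot>\<^bsub>C\<^esub> f = v \<cdot>\<^bsub>C\<^esub> g)"

definition independent_square ::
    "('o, 'm, 'z) markov_data_scheme \<Rightarrow> ('o, 'm) prob_arr \<Rightarrow> ('o, 'm) prob_arr \<Rightarrow>
     ('o, 'm) prob_arr \<Rightarrow> ('o, 'm) prob_arr \<Rightarrow> bool" where
  "independent_square C f g u v \<longleftrightarrow>
     commutative_square (Samp C) f g u v \<and>
     (let d = u \<cdot>\<^bsub>Samp C\<^esub> f; (_, p\<^sub>\<Omega>) = src f; (X, _) = tgt f; (Y, _) = tgt g; (Z, p\<^sub>Z) = tgt u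
      in \<exists>\<phi> \<in> Hom C Z X. \<exists>\<psi> \<in> Hom C Z Y.
           tripling C (rep f) (rep d) (rep g) \<cdot>\<^bsub>C\<^esub> p\<^sub>\<Omega> = tripling C \<phi> (Id C Z) \<psi> \<cdot>\<^bsub>C\<^esub> p\<^sub>Z)"

definition independent_pullback ::
    "('o, 'm, 'z) markov_data_scheme \<Rightarrow> ('o, 'm) prob_arr \<Rightarrow> ('o, 'm) prob_arr \<Rightarrow>
     ('o, 'm) prob_arr \<Rightarrow> ('o, 'm) prob_arr \<Rightarrow> bool" where
  "independent_pullback C f g u v \<longleftrightarrow>
     independent_square C f g u v \<and>
     (\<forall>f' g'. independent_square C f' g' u v \<longrightarrow>
        (\<exists>!h. h \<in> Hom (Samp C) (src f') (src f) \<and>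
              f \<cdot>\<^bsub>Samp C\<^esub> h = f' \<and> g \<cdot>\<^bsub>Samp C\<^esub> h = g'))"

end

theory Submission
  imports Defs
begin

text \<open>The vertex of the independent pullback is the relative product of \<open>X\<^sub>1\<close> and \<open>X\<^sub>2\<close>
  over \<open>Y\<close>.  Conditionals provide Bayesian inverses \<open>a : Y \<rightarrow> X\<^sub>1\<close> and \<open>b : Y \<rightarrow> X\<^sub>2\<close> of \<open>u\<close> and
  \<open>v\<close>, with \<open>\<langle>id, u\<rangle> \<cdot> p\<^sub>1 = \<langle>a, id\<rangle> \<cdot> q\<close> and likewise for \<open>b\<close>.  The vertex is
  \<open>X\<^sub>1 \<boxtimes> X\<^sub>2\<close> with state \<open>\<langle>a, b\<rangle> \<cdot> q\<close>: draw a point of \<open>Y\<close>, then draw points of the two fibres over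
  it independently.  The legs are the two projections.

  Because \<open>u\<close> is almost surely deterministic, \<open>a\<close> is concentrated on the fibres of \<open>u\<close>: running \<open>a\<close>
  and recording the value of \<open>u\<close> at the result returns the point of \<open>Y\<close> at which \<open>a\<close> was started
  (\<open>disintegration_fibre\<close>).  Hence \<open>u\<close> after the first projection and \<open>v\<close> after the second are
  almost surely equal, both recovering the drawn point of \<open>Y\<close>
  (\<open>graph_of_disintegrated_pair\<close>), and the same computation exhibits the square as independent,
  with witnesses \<open>a\<close> and \<open>b\<close>.

  Let \<open>F\<close>, \<open>G\<close> be the legs of another independent square, with witnesses \<open>\<phi>\<close>, \<open>\<psi>\<close>.  Since \<open>F\<close> is
  almost surely deterministic, marginalising the independence equation shows that \<open>\<phi>\<close> is again a
  Bayesian inverse of \<open>u\<close>, and such inverses are almost surely unique; the same holds for \<open>\<psi>\<close>.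
  Therefore \<open>\<langle>F, G\<rangle>\<close> carries the state of the new vertex to \<open>\<langle>\<phi>, \<psi>\<rangle> \<cdot> q = \<langle>a, b\<rangle> \<cdot> q\<close>
  (\<open>independent_joint_state\<close>), so it is a morphism of sample spaces.  It is the only one with the
  required composites, since an almost surely deterministic map into a tensor product is
  determined by its two components (\<open>as_deterministic_eq_pairing\<close>).

  String diagrams are replaced by a calculus of pairings \<open>\<langle>f, g\<rangle>\<close>.  Associators, swaps and
  projections act on nested pairings by rearranging or dropping components, and
  \<open>\<langle>\<pi>\<^sub>1, \<pi>\<^sub>2\<rangle> = id\<close>, so that no coherence theorem is needed: an equation of structural maps is
  checked on components.  What distinguishes this from a cartesian category is that
  \<open>\<langle>f, g\<rangle> \<cdot> h = \<langle>f \<cdot> h, g \<cdot> h\<rangle>\<close> requires \<open>h\<close> to be deterministic, or holds almost surely if \<open>h\<close> is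
  almost surely deterministic (\<open>as_deterministic_pairing_comp\<close>).\<close>

section \<open>Typing and composition\<close>

context category
begin

lemma Hom_iff: "f \<in> Hom C X Y \<longleftrightarrow> f \<in> Arr C \<and> Dom C f = X \<and> Cod C f = Y"
  by (simp add: Hom_def)

lemma comp_typing [simp]:
  assumes "f \<in> Arr C" "g \<in> Arr C" "Dom C g = Cod C f"
  shows "g \<cdot> f \<in> Arr C" "Dom C (g \<cdot> f) = Dom C f" "Cod C (g \<cdot> f) = Cod C g"
  using Comp_Hom[of f "Dom C f" "Cod C f" g "Cod C g"] assms by (auto simp: Hom_iff)

lemma id_typing [simp]:
  assumes "X \<in> Obj C"
  shows "Id C X \<in> Arr C" "Dom C (Id C X) = X" "Cod C (Id C X) = X"
  using Id_Hom[OF assms] by (auto simp: Hom_iff)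

lemma comp_id [simp]:
  assumes "f \<in> Arr C"
  shows "Cod C f = X \<Longrightarrow> Id C X \<cdot> f = f" "Dom C f = X \<Longrightarrow> f \<cdot> Id C X = f"
  using assms Comp_Id_left[of f "Dom C f" "Cod C f"] Comp_Id_right[of f "Dom C f" "Cod C f"]
  by (auto simp: Hom_iff)

lemma comp_assoc [simp]:
  assumes "f \<in> Arr C" "g \<in> Arr C" "h \<in> Arr C" "Dom C g = Cod C f" "Dom C h = Cod C g"
  shows "(h \<cdot> g) \<cdot> f = h \<cdot> g \<cdot> f"
  using assms Comp_assoc[of f "Dom C f" "Cod C f" g "Cod C g" h "Cod C h"] by (auto simp: Hom_iff)

declare Dom_Obj [simp] Cod_Obj [simp]

text \<open>Composites are normalised to the right, so an equation for a composite of two arrows also has to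
  be available with a further arrow \<open>k\<close> attached.\<close>

lemma comp_extend:
  assumes "a \<cdot> b = c" "a \<in> Arr C" "b \<in> Arr C" "k \<in> Arr C" "Dom C a = Cod C b" "Dom C b = Cod C k"
  shows "a \<cdot> b \<cdot> k = c \<cdot> k"
  using assms comp_assoc[of k b a] by auto

lemma is_inverse_inv_arr:
  assumes "iso_arr C f"
  shows "is_inverse C f (inv_arr C f)"
proof -
  obtain g where g: "is_inverse C f g"
    using assms by (auto simp: iso_arr_def)
  have "h = g" if h: "is_inverse C f h" for h
  proof -
    have "h = h \<cdot> f \<cdot> g"
      using g h by (auto simp: is_inverse_def Hom_iff)
    also have "\<dots> = (h \<cdot> f) \<cdot> g"
      by (rule comp_assoc[symmetric]) (use g h in \<open>auto simp: is_inverse_def Hom_iff\<close>)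
    also have "\<dots> = g"
      using g h by (auto simp: is_inverse_def Hom_iff simp del: comp_assoc)
    finally show ?thesis .
  qed
  with g show ?thesis
    unfolding inv_arr_def by (metis theI)
qed

lemma inv_arr_simps:
  assumes "iso_arr C f"
  shows "inv_arr C f \<in> Arr C" "Dom C (inv_arr C f) = Cod C f" "Cod C (inv_arr C f) = Dom C f"
    "inv_arr C f \<cdot> f = Id C (Dom C f)" "f \<cdot> inv_arr C f = Id C (Cod C f)"
  using is_inverse_inv_arr[OF assms] by (auto simp: is_inverse_def Hom_iff)

lemma iso_cancel_left:
  assumes "iso_arr C h" "h \<in> Arr C" "f \<in> Hom C X (Dom C h)" "g \<in> Hom C X (Dom C h)" "h \<cdot> f = h \<cdot> g"
  shows "f = g"
proof -
  have "inv_arr C h \<cdot> h \<cdot> k = k" if "k \<in> Hom C X (Dom C h)" for k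
  proof -
    have "inv_arr C h \<cdot> h \<cdot> k = (inv_arr C h \<cdot> h) \<cdot> k"
      by (rule comp_assoc[symmetric]) (use that assms(2) inv_arr_simps[OF assms(1)] in \<open>simp_all add: Hom_iff\<close>)
    then show ?thesis
      using that inv_arr_simps(4)[OF assms(1)] by (simp add: Hom_iff)
  qed
  from this[OF assms(3)] this[OF assms(4)]
  show ?thesis unfolding assms(5) by simp
qed

end


section \<open>Naturality of the structural isomorphisms\<close>

context symmetric_monoidal_category
begin

declare Unit_Obj [simp] TensorO_Obj [simp]

lemma tensor_typing [simp]:
  assumes "f \<in> Arr C" "g \<in> Arr C"
  shows "f \<otimes> g \<in> Arr C" "Dom C (f \<otimes> g) = Dom C f \<boxtimes> Dom C g"
    "Cod C (f \<otimes> g) = Cod C f \<boxtimes> Cod C g"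
  using TensorM_Hom[of f "Dom C f" "Cod C f" g "Dom C g" "Cod C g"] assms by (auto simp: Hom_iff)

lemma tensor_id [simp]: "X \<in> Obj C \<Longrightarrow> Y \<in> Obj C \<Longrightarrow> Id C X \<otimes> Id C Y = Id C (X \<boxtimes> Y)"
  by (rule TensorM_Id)

lemma interchange [simp]:
  assumes "f \<in> Arr C" "g \<in> Arr C" "a \<in> Arr C" "b \<in> Arr C" "Dom C a = Cod C f" "Dom C b = Cod C g"
  shows "(a \<otimes> b) \<cdot> (f \<otimes> g) = (a \<cdot> f) \<otimes> (b \<cdot> g)"
  using assms TensorM_Comp[of f "Dom C f" "Cod C f" a "Cod C a" g "Dom C g" "Cod C g" b "Cod C b"]
  by (auto simp: Hom_iff)

lemma interchange_extend [simp]: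
  assumes "f \<in> Arr C" "g \<in> Arr C" "a \<in> Arr C" "b \<in> Arr C" "Dom C a = Cod C f" "Dom C b = Cod C g"
    "k \<in> Arr C" "Cod C k = Dom C f \<boxtimes> Dom C g"
  shows "(a \<otimes> b) \<cdot> (f \<otimes> g) \<cdot> k = ((a \<cdot> f) \<otimes> (b \<cdot> g)) \<cdot> k"
  by (rule comp_extend) (use assms in auto)

lemma structure_typing [simp]:
  assumes "X \<in> Obj C"
  shows "Lunit C X \<in> Arr C" "Dom C (Lunit C X) = Unit C \<boxtimes> X" "Cod C (Lunit C X) = X"
    "Runit C X \<in> Arr C" "Dom C (Runit C X) = X \<boxtimes> Unit C" "Cod C (Runit C X) = X"
    "Y \<in> Obj C \<Longrightarrow> Swap C X Y \<in> Arr C"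
    "Y \<in> Obj C \<Longrightarrow> Dom C (Swap C X Y) = X \<boxtimes> Y" "Y \<in> Obj C \<Longrightarrow> Cod C (Swap C X Y) = Y \<boxtimes> X"
    "Y \<in> Obj C \<Longrightarrow> Z \<in> Obj C \<Longrightarrow> Assoc C X Y Z \<in> Arr C"
    "Y \<in> Obj C \<Longrightarrow> Z \<in> Obj C \<Longrightarrow> Dom C (Assoc C X Y Z) = (X \<boxtimes> Y) \<boxtimes> Z"
    "Y \<in> Obj C \<Longrightarrow> Z \<in> Obj C \<Longrightarrow> Cod C (Assoc C X Y Z) = X \<boxtimes> Y \<boxtimes> Z"
    "Y \<in> Obj C \<Longrightarrow> Z \<in> Obj C \<Longrightarrow> inv_arr C (Assoc C X Y Z) \<in> Arr C"
    "Y \<in> Obj C \<Longrightarrow> Z \<in> Obj C \<Longrightarrow> Dom C (inv_arr C (Assoc C X Y Z)) = X \<boxtimes> Y \<boxtimes> Z"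
    "Y \<in> Obj C \<Longrightarrow> Z \<in> Obj C \<Longrightarrow> Cod C (inv_arr C (Assoc C X Y Z)) = (X \<boxtimes> Y) \<boxtimes> Z"
  using assms Lunit_Hom[of X] Runit_Hom[of X] Swap_Hom[of X Y] Assoc_Hom[of X Y Z]
    inv_arr_simps[OF Assoc_iso[of X Y Z]]
  by (auto simp: Hom_iff)

lemma assoc_inverse [simp]:
  assumes "X \<in> Obj C" "Y \<in> Obj C" "Z \<in> Obj C"
  shows "inv_arr C (Assoc C X Y Z) \<cdot> Assoc C X Y Z = Id C ((X \<boxtimes> Y) \<boxtimes> Z)"
    "Assoc C X Y Z \<cdot> inv_arr C (Assoc C X Y Z) = Id C (X \<boxtimes> Y \<boxtimes> Z)"
  using assms inv_arr_simps[OF Assoc_iso[of X Y Z]] by auto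

lemma mid_swap_typing [simp]:
  assumes "W \<in> Obj C" "X \<in> Obj C" "Y \<in> Obj C" "Z \<in> Obj C"
  shows "mid_swap C W X Y Z \<in> Arr C"
    "Dom C (mid_swap C W X Y Z) = (W \<boxtimes> X) \<boxtimes> Y \<boxtimes> Z"
    "Cod C (mid_swap C W X Y Z) = (W \<boxtimes> Y) \<boxtimes> X \<boxtimes> Z"
  using assms by (auto simp: mid_swap_def)

lemma inv_assoc_natural:
  assumes "a \<in> Arr C" "b \<in> Arr C" "c \<in> Arr C"
  shows "inv_arr C (Assoc C (Cod C a) (Cod C b) (Cod C c)) \<cdot> (a \<otimes> b \<otimes> c)
    = ((a \<otimes> b) \<otimes> c) \<cdot> inv_arr C (Assoc C (Dom C a) (Dom C b) (Dom C c))" (is "?J \<cdot> ?t = ?s \<cdot> ?I")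
proof -
  let ?A = "Assoc C (Dom C a) (Dom C b) (Dom C c)" and ?B = "Assoc C (Cod C a) (Cod C b) (Cod C c)"
  \<comment> \<open>Conjugate the naturality square of the associator by its inverses.\<close>
  have nat: "?B \<cdot> ?s = ?t \<cdot> ?A"
    by (rule Assoc_natural) (use assms in \<open>auto simp: Hom_iff\<close>)
  have "?J \<cdot> ?t = ?J \<cdot> ?t \<cdot> ?A \<cdot> ?I"
    using assms by simp
  also have "\<dots> = ?J \<cdot> (?t \<cdot> ?A) \<cdot> ?I"
    using assms by (subst comp_assoc) auto
  also have "\<dots> = (?J \<cdot> ?B) \<cdot> ?s \<cdot> ?I"
    using assms unfolding nat[symmetric] by (simp del: assoc_inverse)
  also have "\<dots> = ?s \<cdot> ?I"
    using assms by simp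
  finally show ?thesis .
qed

lemma mid_swap_natural:
  assumes "a \<in> Arr C" "b \<in> Arr C" "c \<in> Arr C" "d \<in> Arr C"
  shows "mid_swap C (Cod C a) (Cod C b) (Cod C c) (Cod C d) \<cdot> ((a \<otimes> b) \<otimes> c \<otimes> d)
    = ((a \<otimes> c) \<otimes> b \<otimes> d) \<cdot> mid_swap C (Dom C a) (Dom C b) (Dom C c) (Dom C d)"
proof -
  let ?inner = "\<lambda>X Y Z. Assoc C Y X Z \<cdot> (Swap C X Y \<otimes> Id C Z) \<cdot> inv_arr C (Assoc C X Y Z)"
  have "?inner (Cod C b) (Cod C c) (Cod C d) \<cdot> (b \<otimes> c \<otimes> d)
      = Assoc C (Cod C c) (Cod C b) (Cod C d) \<cdot> (Swap C (Cod C b) (Cod C c) \<otimes> Id C (Cod C d))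
        \<cdot> ((b \<otimes> c) \<otimes> d) \<cdot> inv_arr C (Assoc C (Dom C b) (Dom C c) (Dom C d))"
    using assms inv_assoc_natural[of b c d] by simp
  also have "\<dots> = Assoc C (Cod C c) (Cod C b) (Cod C d) \<cdot> ((c \<otimes> b) \<otimes> d)
        \<cdot> (Swap C (Dom C b) (Dom C c) \<otimes> Id C (Dom C d))
        \<cdot> inv_arr C (Assoc C (Dom C b) (Dom C c) (Dom C d))"
    using assms Swap_natural[of b "Dom C b" "Cod C b" c "Dom C c" "Cod C c"] by (simp add: Hom_iff)
  also have "\<dots> = (c \<otimes> b \<otimes> d) \<cdot> ?inner (Dom C b) (Dom C c) (Dom C d)"
    using assms comp_extend[OF Assoc_natural[of c "Dom C c" "Cod C c" b "Dom C b" "Cod C b" d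
      "Dom C d" "Cod C d"]]
    by (simp add: Hom_iff del: interchange_extend)
  finally have inner: "?inner (Cod C b) (Cod C c) (Cod C d) \<cdot> (b \<otimes> c \<otimes> d)
      = (c \<otimes> b \<otimes> d) \<cdot> ?inner (Dom C b) (Dom C c) (Dom C d)" .
  have "mid_swap C (Cod C a) (Cod C b) (Cod C c) (Cod C d) \<cdot> ((a \<otimes> b) \<otimes> c \<otimes> d)
      = inv_arr C (Assoc C (Cod C a) (Cod C c) (Cod C b \<boxtimes> Cod C d))
        \<cdot> (a \<otimes> (?inner (Cod C b) (Cod C c) (Cod C d) \<cdot> (b \<otimes> c \<otimes> d)))
        \<cdot> Assoc C (Dom C a) (Dom C b) (Dom C c \<boxtimes> Dom C d)"
    using assms Assoc_natural[of a "Dom C a" "Cod C a" b "Dom C b" "Cod C b" "c \<otimes> d"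
      "Dom C c \<boxtimes> Dom C d" "Cod C c \<boxtimes> Cod C d"]
    by (simp add: Hom_iff mid_swap_def)
  also have "\<dots> = inv_arr C (Assoc C (Cod C a) (Cod C c) (Cod C b \<boxtimes> Cod C d))
        \<cdot> (a \<otimes> (c \<otimes> b \<otimes> d)) \<cdot> (Id C (Dom C a) \<otimes> ?inner (Dom C b) (Dom C c) (Dom C d))
        \<cdot> Assoc C (Dom C a) (Dom C b) (Dom C c \<boxtimes> Dom C d)"
    unfolding inner using assms by simp
  also have "\<dots> = ((a \<otimes> c) \<otimes> b \<otimes> d) \<cdot> mid_swap C (Dom C a) (Dom C b) (Dom C c) (Dom C d)"
    using assms comp_extend[OF inv_assoc_natural[of a c "b \<otimes> d"]]
    by (simp add: mid_swap_def del: interchange_extend)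
  finally show ?thesis .
qed

end


section \<open>Calculus of pairings\<close>

context markov_category
begin

abbreviation pair ("\<langle>_,/ _\<rangle>") where "\<langle>f, g\<rangle> \<equiv> pairing C f g"

lemma copy_del_typing [simp]:
  assumes "X \<in> Obj C"
  shows "Copy C X \<in> Arr C" "Dom C (Copy C X) = X" "Cod C (Copy C X) = X \<boxtimes> X"
    "Del C X \<in> Arr C" "Dom C (Del C X) = X" "Cod C (Del C X) = Unit C"
  using assms Copy_Hom[of X] Del_Hom[of X] by (auto simp: Hom_iff)

lemma unit_arrow_eq_del:
  assumes "e \<in> Arr C" "Cod C e = Unit C"
  shows "e = Del C (Dom C e)"
  using assms Unit_terminal[of "Dom C e"] Del_Hom[of "Dom C e"] by (auto simp: Hom_iff)

lemma pairing_typing [simp]: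
  assumes "f \<in> Arr C" "g \<in> Arr C" "Dom C g = Dom C f"
  shows "\<langle>f, g\<rangle> \<in> Arr C" "Dom C \<langle>f, g\<rangle> = Dom C f" "Cod C \<langle>f, g\<rangle> = Cod C f \<boxtimes> Cod C g"
  using assms by (auto simp: pairing_def)

lemma copy_eq_pairing: "X \<in> Obj C \<Longrightarrow> Copy C X = \<langle>Id C X, Id C X\<rangle>"
  by (simp add: pairing_def)

lemma tensor_pairing [simp]:
  assumes "f \<in> Arr C" "g \<in> Arr C" "Dom C g = Dom C f"
    "a \<in> Arr C" "b \<in> Arr C" "Dom C a = Cod C f" "Dom C b = Cod C g"
  shows "(a \<otimes> b) \<cdot> \<langle>f, g\<rangle> = \<langle>a \<cdot> f, b \<cdot> g\<rangle>"
  using assms by (simp add: pairing_def)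

lemma tensor_copy:
  assumes "a \<in> Arr C" "b \<in> Arr C" "Dom C a = X" "Dom C b = X"
  shows "(a \<otimes> b) \<cdot> Copy C X = \<langle>a, b\<rangle>"
  using assms by (simp add: pairing_def)

text \<open>This is coassociativity of copying, transported along \<open>f\<close>, \<open>g\<close>, \<open>h\<close> by naturality of the
  associator.  The swap law below arises in the same way from commutativity of copying.\<close>

lemma assoc_pairing [simp]:
  assumes "f \<in> Arr C" "g \<in> Arr C" "h \<in> Arr C" "Dom C g = Dom C f" "Dom C h = Dom C f"
    "Cod C f = X" "Cod C g = Y" "Cod C h = Z"
  shows "Assoc C X Y Z \<cdot> \<langle>\<langle>f, g\<rangle>, h\<rangle> = \<langle>f, \<langle>g, h\<rangle>\<rangle>"
proof -
  let ?A = "Dom C f"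
  have "Assoc C X Y Z \<cdot> \<langle>\<langle>f, g\<rangle>, h\<rangle>
      = Assoc C X Y Z \<cdot> ((f \<otimes> g) \<otimes> h) \<cdot> (Copy C ?A \<otimes> Id C ?A) \<cdot> Copy C ?A"
    using assms by (auto simp add: pairing_def)
  also have "\<dots> = (f \<otimes> g \<otimes> h) \<cdot> Assoc C ?A ?A ?A \<cdot> (Copy C ?A \<otimes> Id C ?A) \<cdot> Copy C ?A"
    using assms comp_extend[OF Assoc_natural[of f ?A X g ?A Y h ?A Z]]
    by (auto simp add: Hom_iff simp del: interchange_extend)
  also have "\<dots> = (f \<otimes> g \<otimes> h) \<cdot> (Id C ?A \<otimes> Copy C ?A) \<cdot> Copy C ?A"
    using assms by (simp add: Copy_coassoc del: interchange_extend)
  also have "\<dots> = \<langle>f, \<langle>g, h\<rangle>\<rangle>"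
    using assms by (auto simp add: pairing_def)
  finally show ?thesis .
qed

lemma inv_assoc_pairing [simp]:
  assumes "f \<in> Arr C" "g \<in> Arr C" "h \<in> Arr C" "Dom C g = Dom C f" "Dom C h = Dom C f"
    "Cod C f = X" "Cod C g = Y" "Cod C h = Z"
  shows "inv_arr C (Assoc C X Y Z) \<cdot> \<langle>f, \<langle>g, h\<rangle>\<rangle> = \<langle>\<langle>f, g\<rangle>, h\<rangle>"
proof -
  have "inv_arr C (Assoc C X Y Z) \<cdot> \<langle>f, \<langle>g, h\<rangle>\<rangle>
      = (inv_arr C (Assoc C X Y Z) \<cdot> Assoc C X Y Z) \<cdot> \<langle>\<langle>f, g\<rangle>, h\<rangle>"
    using assms by (subst comp_assoc) (auto simp del: assoc_inverse)
  then show ?thesis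
    using assms by auto
qed

lemma swap_pairing [simp]:
  assumes "f \<in> Arr C" "g \<in> Arr C" "Dom C g = Dom C f" "Cod C f = X" "Cod C g = Y"
  shows "Swap C X Y \<cdot> \<langle>f, g\<rangle> = \<langle>g, f\<rangle>"
  using assms comp_extend[OF Swap_natural[of f "Dom C f" X g "Dom C f" Y]]
  by (auto simp: pairing_def Hom_iff Copy_commutative)

lemma mid_swap_pairing [simp]:
  assumes "f \<in> Arr C" "g \<in> Arr C" "h \<in> Arr C" "k \<in> Arr C"
    "Dom C g = Dom C f" "Dom C h = Dom C f" "Dom C k = Dom C f"
    "Cod C f = W" "Cod C g = X" "Cod C h = Y" "Cod C k = Z"
  shows "mid_swap C W X Y Z \<cdot> \<langle>\<langle>f, g\<rangle>, \<langle>h, k\<rangle>\<rangle> = \<langle>\<langle>f, h\<rangle>, \<langle>g, k\<rangle>\<rangle>"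
  using assms by (auto simp: mid_swap_def)

lemma proj_typing [simp]:
  assumes "X \<in> Obj C" "Y \<in> Obj C"
  shows "proj_left C X Y \<in> Arr C" "Dom C (proj_left C X Y) = X \<boxtimes> Y" "Cod C (proj_left C X Y) = X"
    "proj_right C X Y \<in> Arr C" "Dom C (proj_right C X Y) = X \<boxtimes> Y" "Cod C (proj_right C X Y) = Y"
  using assms by (auto simp: proj_left_def proj_right_def)

text \<open>The unit is terminal, so \<open>e\<close> is deletion and the counit law of the comonoid applies.\<close>

lemma runit_pairing:
  assumes "f \<in> Arr C" "e \<in> Arr C" "Dom C e = Dom C f" "Cod C f = X" "Cod C e = Unit C"
  shows "Runit C X \<cdot> \<langle>f, e\<rangle> = f"
proof -
  have e: "e = Del C (Dom C f)"
    using assms unit_arrow_eq_del[of e] by simp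
  have "\<langle>f, e\<rangle> = (f \<otimes> Id C (Unit C)) \<cdot> (Id C (Dom C f) \<otimes> Del C (Dom C f)) \<cdot> Copy C (Dom C f)"
    unfolding e pairing_def using assms by simp
  then have "Runit C X \<cdot> \<langle>f, e\<rangle>
      = f \<cdot> Runit C (Dom C f) \<cdot> (Id C (Dom C f) \<otimes> Del C (Dom C f)) \<cdot> Copy C (Dom C f)"
    using assms comp_extend[OF Runit_natural[of f "Dom C f" X]]
    by (auto simp: Hom_iff simp del: interchange_extend)
  then show ?thesis
    using assms by (simp add: Copy_counit_right)
qed

lemma lunit_pairing:
  assumes "f \<in> Arr C" "e \<in> Arr C" "Dom C e = Dom C f" "Cod C f = X" "Cod C e = Unit C"
  shows "Lunit C X \<cdot> \<langle>e, f\<rangle> = f"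
proof -
  have e: "e = Del C (Dom C f)"
    using assms unit_arrow_eq_del[of e] by simp
  have "\<langle>e, f\<rangle> = (Id C (Unit C) \<otimes> f) \<cdot> (Del C (Dom C f) \<otimes> Id C (Dom C f)) \<cdot> Copy C (Dom C f)"
    unfolding e pairing_def using assms by simp
  then have "Lunit C X \<cdot> \<langle>e, f\<rangle>
      = f \<cdot> Lunit C (Dom C f) \<cdot> (Del C (Dom C f) \<otimes> Id C (Dom C f)) \<cdot> Copy C (Dom C f)"
    using assms comp_extend[OF Lunit_natural[of f "Dom C f" X]]
    by (auto simp: Hom_iff simp del: interchange_extend)
  then show ?thesis
    using assms by (simp add: Copy_counit_left)
qed

lemma proj_pairing [simp]:
  assumes "f \<in> Arr C" "g \<in> Arr C" "Dom C g = Dom C f" "Cod C f = X" "Cod C g = Y"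
  shows "proj_left C X Y \<cdot> \<langle>f, g\<rangle> = f" "proj_right C X Y \<cdot> \<langle>f, g\<rangle> = g"
  using assms by (auto simp: proj_left_def proj_right_def runit_pairing lunit_pairing)

lemma proj_left_tensor:
  assumes "f \<in> Arr C" "e \<in> Arr C" "Cod C f = X" "Cod C e = Y"
  shows "proj_left C X Y \<cdot> (f \<otimes> e) = f \<cdot> proj_left C (Dom C f) (Dom C e)"
proof -
  have obj: "X \<in> Obj C" "Y \<in> Obj C"
    using assms Cod_Obj by auto
  have e: "Del C Y \<cdot> e = Del C (Dom C e)"
    using assms obj unit_arrow_eq_del[of "Del C Y \<cdot> e"] by simp
  have "proj_left C X Y \<cdot> (f \<otimes> e)
    = Runit C X \<cdot> (f \<otimes> Id C (Unit C)) \<cdot> (Id C (Dom C f) \<otimes> Del C (Dom C e))"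
    using assms obj by (simp add: proj_left_def e)
  also have "\<dots> = f \<cdot> proj_left C (Dom C f) (Dom C e)"
    using assms comp_extend[OF Runit_natural[of f "Dom C f" X]]
    by (auto simp: proj_left_def Hom_iff simp del: interchange interchange_extend)
  finally show ?thesis .
qed

text \<open>\<open>I \<boxtimes> I\<close> is isomorphic to the terminal object \<open>I\<close>.  This settles every coherence question that
  concerns only units, such as \<open>Swap I I = id\<close>.\<close>

lemma unit_tensor_unit_terminal:
  assumes "f \<in> Arr C" "g \<in> Arr C" "Dom C f = Dom C g"
    "Cod C f = Unit C \<boxtimes> Unit C" "Cod C g = Unit C \<boxtimes> Unit C"
  shows "f = g"
proof -
  let ?r = "Runit C (Unit C)"
  have "?r \<cdot> f = ?r \<cdot> g"
    using assms unit_arrow_eq_del[of "?r \<cdot> f"] unit_arrow_eq_del[of "?r \<cdot> g"] by simp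
  with assms show ?thesis
    using iso_cancel_left[OF Runit_iso[of "Unit C"], of f "Dom C g" g] by (simp add: Hom_iff)
qed

text \<open>Deleting commutes with the middle swap by naturality.  After deleting, the two factors being
  exchanged are units, whose swap is the identity, and the counit laws remain.\<close>

lemma pairing_proj:
  assumes "X \<in> Obj C" "Y \<in> Obj C"
  shows "\<langle>proj_left C X Y, proj_right C X Y\<rangle> = Id C (X \<boxtimes> Y)"
proof -
  let ?I = "Unit C"
  have "Swap C ?I ?I = Id C (?I \<boxtimes> ?I)"
    by (rule unit_tensor_unit_terminal) auto
  then have unit_swap: "mid_swap C X ?I ?I Y = Id C ((X \<boxtimes> ?I) \<boxtimes> ?I \<boxtimes> Y)"
    using assms by (simp add: mid_swap_def)
  have "\<langle>proj_left C X Y, proj_right C X Y\<rangle> = (Runit C X \<otimes> Lunit C Y) \<cdot>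
      (((Id C X \<otimes> Del C Y) \<otimes> Del C X \<otimes> Id C Y) \<cdot> mid_swap C X X Y Y) \<cdot> (Copy C X \<otimes> Copy C Y)"
    using assms by (simp add: pairing_def proj_left_def proj_right_def Copy_TensorO)
  also have "((Id C X \<otimes> Del C Y) \<otimes> Del C X \<otimes> Id C Y) \<cdot> mid_swap C X X Y Y
      = (Id C X \<otimes> Del C X) \<otimes> Del C Y \<otimes> Id C Y"
    using assms mid_swap_natural[of "Id C X" "Del C X" "Del C Y" "Id C Y"]
    by (simp add: unit_swap)
  also have "(Runit C X \<otimes> Lunit C Y) \<cdot> \<dots> \<cdot> (Copy C X \<otimes> Copy C Y) = Id C (X \<boxtimes> Y)"
    using assms by (simp add: Copy_counit_left Copy_counit_right)
  finally show ?thesis .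
qed

text \<open>Tensoring with \<open>I \<boxtimes> I\<close> adds no information: the projection has a left inverse \<open>K\<close>, and any
  section of it, such as \<open>\<langle>id, D\<rangle>\<close>, must coincide with \<open>K\<close>.  Hence arrows out of
  \<open>Q \<boxtimes> (I \<boxtimes> I)\<close> may be compared after precomposition with a pairing.\<close>

lemma proj_left_units_inverse:
  assumes "Q \<in> Obj C" "D \<in> Hom C Q (Unit C \<boxtimes> Unit C)"
  shows "\<langle>Id C Q, D\<rangle> \<cdot> proj_left C Q (Unit C \<boxtimes> Unit C) = Id C (Q \<boxtimes> Unit C \<boxtimes> Unit C)"
proof -
  let ?I = "Unit C"
  let ?r = "Runit C Q"
  let ?P = "proj_left C Q (?I \<boxtimes> ?I)"
  let ?J = "\<langle>Id C Q, D\<rangle>"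
  define K where "K = (Id C Q \<otimes> Copy C ?I) \<cdot> inv_arr C ?r"
  have inv: "inv_arr C ?r \<cdot> ?r = Id C (Q \<boxtimes> ?I)" "inv_arr C ?r \<in> Arr C"
    "Dom C (inv_arr C ?r) = Q" "Cod C (inv_arr C ?r) = Q \<boxtimes> ?I"
    using inv_arr_simps[OF Runit_iso[of Q]] assms by auto
  have D: "D \<in> Arr C" "Dom C D = Q" "Cod C D = ?I \<boxtimes> ?I"
    using assms by (auto simp: Hom_iff)
  have units: "Copy C ?I \<cdot> Del C (?I \<boxtimes> ?I) = Id C (?I \<boxtimes> ?I)"
    by (rule unit_tensor_unit_terminal) auto
  have "K \<cdot> ?P = (Id C Q \<otimes> Copy C ?I) \<cdot> (inv_arr C ?r \<cdot> ?r) \<cdot> (Id C Q \<otimes> Del C (?I \<boxtimes> ?I))"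
    using assms inv(2-4) by (simp add: K_def proj_left_def)
  then have KP: "K \<cdot> ?P = Id C (Q \<boxtimes> ?I \<boxtimes> ?I)"
    using assms inv(1) by (simp add: units)
  have K: "K \<in> Arr C" "Dom C K = Q" "Cod C K = Q \<boxtimes> ?I \<boxtimes> ?I"
    using assms inv by (simp_all add: K_def)
  have "?J = (K \<cdot> ?P) \<cdot> ?J"
    using assms D by (simp add: KP)
  also have "\<dots> = K \<cdot> ?P \<cdot> ?J"
    by (rule comp_assoc) (use assms D K in simp_all)
  also have "\<dots> = K"
    using assms D K by simp
  finally show ?thesis
    using KP by simp
qed

text \<open>Projections are deterministic.  By naturality of the middle swap, the two deletions inside
  \<open>\<langle>\<pi>\<^sub>1, \<pi>\<^sub>1\<rangle>\<close> can be performed first.  What is left is a map out of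
  \<open>(X \<boxtimes> X) \<boxtimes> (I \<boxtimes> I)\<close>, which is recognised as the projection by testing it on pairings.\<close>

lemma copy_proj_left:
  assumes "X \<in> Obj C" "Y \<in> Obj C"
  shows "Copy C X \<cdot> proj_left C X Y = \<langle>proj_left C X Y, proj_left C X Y\<rangle>"
proof -
  let ?I = "Unit C"
  let ?Q = "X \<boxtimes> X"
  let ?M = "mid_swap C X X ?I ?I"
  let ?P = "proj_left C ?Q (?I \<boxtimes> ?I)"
  define D where "D = \<langle>Del C ?Q, Del C ?Q\<rangle>"
  define J where "J = \<langle>Id C ?Q, D\<rangle>"
  have D: "D \<in> Arr C" "Dom C D = ?Q" "Cod C D = ?I \<boxtimes> ?I"
    and J: "J \<in> Arr C" "Dom C J = ?Q" "Cod C J = ?Q \<boxtimes> ?I \<boxtimes> ?I"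
    using assms by (simp_all add: D_def J_def)
  have JP: "J \<cdot> ?P = Id C (?Q \<boxtimes> ?I \<boxtimes> ?I)"
    unfolding J_def using assms D by (intro proj_left_units_inverse) (simp_all add: Hom_iff)
  have "(Runit C X \<otimes> Runit C X) \<cdot> ?M \<cdot> J = Id C ?Q"
    unfolding J_def D_def pairing_proj[OF assms(1) assms(1), symmetric]
    using assms by (simp add: runit_pairing)
  then have "((Runit C X \<otimes> Runit C X) \<cdot> ?M \<cdot> J) \<cdot> ?P = ?P"
    using assms by simp
  then have runits: "(Runit C X \<otimes> Runit C X) \<cdot> ?M = ?P"
    using assms J by (simp add: JP)
  have dels: "(Del C Y \<otimes> Del C Y) \<cdot> Copy C Y = \<langle>Del C Y, Del C Y\<rangle>"
    using assms by (simp add: tensor_copy)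
  have "\<langle>proj_left C X Y, proj_left C X Y\<rangle> = (Runit C X \<otimes> Runit C X) \<cdot>
      (((Id C X \<otimes> Del C Y) \<otimes> Id C X \<otimes> Del C Y) \<cdot> mid_swap C X X Y Y) \<cdot> (Copy C X \<otimes> Copy C Y)"
    using assms by (simp add: pairing_def proj_left_def Copy_TensorO)
  also have "((Id C X \<otimes> Del C Y) \<otimes> Id C X \<otimes> Del C Y) \<cdot> mid_swap C X X Y Y
      = ?M \<cdot> ((Id C X \<otimes> Id C X) \<otimes> Del C Y \<otimes> Del C Y)"
    using assms mid_swap_natural[of "Id C X" "Id C X" "Del C Y" "Del C Y"] by simp
  also have "(Runit C X \<otimes> Runit C X) \<cdot> \<dots> \<cdot> (Copy C X \<otimes> Copy C Y)
      = ((Runit C X \<otimes> Runit C X) \<cdot> ?M) \<cdot> (Copy C X \<otimes> \<langle>Del C Y, Del C Y\<rangle>)"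
    using assms by (simp add: dels)
  also have "\<dots> = Copy C X \<cdot> proj_left C X Y"
    unfolding runits using assms by (simp add: proj_left_tensor)
  finally show ?thesis by simp
qed

text \<open>The swap reduces statements about the right projection to those about the left one.\<close>

lemma proj_right_eq_swap:
  assumes "X \<in> Obj C" "Y \<in> Obj C"
  shows "proj_right C X Y = proj_left C Y X \<cdot> Swap C X Y"
proof -
  have "proj_left C Y X \<cdot> Swap C X Y = proj_left C Y X \<cdot> Swap C X Y \<cdot> \<langle>proj_left C X Y, proj_right C X Y\<rangle>"
    using assms by (simp add: pairing_proj)
  then show ?thesis using assms by simp
qed

lemma proj_right_tensor:
  assumes "f \<in> Arr C" "e \<in> Arr C" "Cod C f = X" "Cod C e = Y"
  shows "proj_right C Y X \<cdot> (e \<otimes> f) = f \<cdot> proj_right C (Dom C e) (Dom C f)"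
proof -
  have obj: "X \<in> Obj C" "Y \<in> Obj C"
    using assms Cod_Obj by auto
  have "proj_right C Y X \<cdot> (e \<otimes> f) = proj_left C X Y \<cdot> (f \<otimes> e) \<cdot> Swap C (Dom C e) (Dom C f)"
    using assms obj Swap_natural[of e "Dom C e" Y f "Dom C f" X]
    by (simp add: proj_right_eq_swap Hom_iff)
  also have "\<dots> = f \<cdot> proj_right C (Dom C e) (Dom C f)"
    using assms obj comp_extend[OF proj_left_tensor[of f e X Y]] by (simp add: proj_right_eq_swap)
  finally show ?thesis .
qed

lemma proj_right_units_inverse:
  assumes "Q \<in> Obj C" "D \<in> Hom C Q (Unit C \<boxtimes> Unit C)"
  shows "\<langle>D, Id C Q\<rangle> \<cdot> proj_right C (Unit C \<boxtimes> Unit C) Q = Id C ((Unit C \<boxtimes> Unit C) \<boxtimes> Q)"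
proof -
  let ?E = "Unit C \<boxtimes> Unit C"
  have D: "D \<in> Arr C" "Dom C D = Q" "Cod C D = ?E"
    using assms by (auto simp: Hom_iff)
  have "\<langle>D, Id C Q\<rangle> \<cdot> proj_right C ?E Q
      = (Swap C Q ?E \<cdot> \<langle>Id C Q, D\<rangle>) \<cdot> proj_left C Q ?E \<cdot> Swap C ?E Q"
    using assms D by (simp add: proj_right_eq_swap)
  also have "\<dots> = Swap C Q ?E \<cdot> (\<langle>Id C Q, D\<rangle> \<cdot> proj_left C Q ?E) \<cdot> Swap C ?E Q"
    using assms(1) D by (simp del: swap_pairing)
  also have "\<dots> = Id C (?E \<boxtimes> Q)"
    using assms by (simp add: proj_left_units_inverse Swap_Swap)
  finally show ?thesis .
qed

text \<open>The mirror image of the argument for the left projection.  Deducing it from that one by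
  swapping the factors would presuppose that the swap is deterministic.\<close>

lemma copy_proj_right:
  assumes "X \<in> Obj C" "Y \<in> Obj C"
  shows "Copy C Y \<cdot> proj_right C X Y = \<langle>proj_right C X Y, proj_right C X Y\<rangle>"
proof -
  let ?I = "Unit C"
  let ?Q = "Y \<boxtimes> Y"
  let ?M = "mid_swap C ?I ?I Y Y"
  let ?P = "proj_right C (?I \<boxtimes> ?I) ?Q"
  define D where "D = \<langle>Del C ?Q, Del C ?Q\<rangle>"
  define J where "J = \<langle>D, Id C ?Q\<rangle>"
  have D: "D \<in> Arr C" "Dom C D = ?Q" "Cod C D = ?I \<boxtimes> ?I"
    and J: "J \<in> Arr C" "Dom C J = ?Q" "Cod C J = (?I \<boxtimes> ?I) \<boxtimes> ?Q"
    using assms by (simp_all add: D_def J_def)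
  have JP: "J \<cdot> ?P = Id C ((?I \<boxtimes> ?I) \<boxtimes> ?Q)"
    unfolding J_def using assms D by (intro proj_right_units_inverse) (simp_all add: Hom_iff)
  have "(Lunit C Y \<otimes> Lunit C Y) \<cdot> ?M \<cdot> J = Id C ?Q"
    unfolding J_def D_def pairing_proj[OF assms(2) assms(2), symmetric]
    using assms by (simp add: lunit_pairing)
  then have "((Lunit C Y \<otimes> Lunit C Y) \<cdot> ?M \<cdot> J) \<cdot> ?P = ?P"
    using assms by simp
  then have lunits: "(Lunit C Y \<otimes> Lunit C Y) \<cdot> ?M = ?P"
    using assms J by (simp add: JP)
  have dels: "(Del C X \<otimes> Del C X) \<cdot> Copy C X = \<langle>Del C X, Del C X\<rangle>"
    using assms by (simp add: tensor_copy)
  have "\<langle>proj_right C X Y, proj_right C X Y\<rangle> = (Lunit C Y \<otimes> Lunit C Y) \<cdot>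
      (((Del C X \<otimes> Id C Y) \<otimes> Del C X \<otimes> Id C Y) \<cdot> mid_swap C X X Y Y) \<cdot> (Copy C X \<otimes> Copy C Y)"
    using assms by (simp add: pairing_def proj_right_def Copy_TensorO)
  also have "((Del C X \<otimes> Id C Y) \<otimes> Del C X \<otimes> Id C Y) \<cdot> mid_swap C X X Y Y
      = ?M \<cdot> ((Del C X \<otimes> Del C X) \<otimes> Id C Y \<otimes> Id C Y)"
    using assms mid_swap_natural[of "Del C X" "Del C X" "Id C Y" "Id C Y"] by simp
  also have "(Lunit C Y \<otimes> Lunit C Y) \<cdot> \<dots> \<cdot> (Copy C X \<otimes> Copy C Y)
      = ((Lunit C Y \<otimes> Lunit C Y) \<cdot> ?M) \<cdot> (\<langle>Del C X, Del C X\<rangle> \<otimes> Copy C Y)"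
    using assms by (simp add: dels)
  also have "\<dots> = Copy C Y \<cdot> proj_right C X Y"
    unfolding lunits using assms by (simp add: proj_right_tensor)
  finally show ?thesis by simp
qed

text \<open>The pairing laws in the form required by right-nested composites.\<close>

lemmas pairing_extend [simp] =
  tensor_pairing [THEN comp_extend] assoc_pairing [THEN comp_extend]
  inv_assoc_pairing [THEN comp_extend] swap_pairing [THEN comp_extend]
  mid_swap_pairing [THEN comp_extend] proj_pairing [THEN comp_extend]


section \<open>Almost sure equality and determinism\<close>

lemma as_eq_refl [simp]: "as_eq C p f f"
  by (simp add: as_eq_def)

lemma as_eq_sym: "as_eq C p f g \<Longrightarrow> as_eq C p g f"
  by (simp add: as_eq_def)

lemma as_eq_trans [trans]: "as_eq C p f g \<Longrightarrow> as_eq C p g h \<Longrightarrow> as_eq C p f h"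
  by (simp add: as_eq_def)

text \<open>Whatever else is computed from the sample space may be kept alongside: the copy of the sample
  point in the definition of almost sure equality is post-processed by \<open>a\<close>.\<close>

lemma as_eq_pairing_state:
  assumes "as_eq C p f g" "p \<in> Arr C" "f \<in> Hom C (Cod C p) Y" "g \<in> Hom C (Cod C p) Y"
    "a \<in> Arr C" "Dom C a = Cod C p"
  shows "\<langle>a, f\<rangle> \<cdot> p = \<langle>a, g\<rangle> \<cdot> p"
proof -
  have "(a \<otimes> Id C Y) \<cdot> \<langle>Id C (Cod C p), f\<rangle> \<cdot> p = (a \<otimes> Id C Y) \<cdot> \<langle>Id C (Cod C p), g\<rangle> \<cdot> p"
    using assms(1) by (simp add: as_eq_def)
  moreover have "Y \<in> Obj C"
    using assms Cod_Obj by (auto simp: Hom_iff)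
  ultimately show ?thesis
    using assms by (simp add: Hom_iff)
qed

lemma as_eq_state:
  assumes "as_eq C p f g" "p \<in> Arr C" "f \<in> Hom C (Cod C p) Y" "g \<in> Hom C (Cod C p) Y"
  shows "f \<cdot> p = g \<cdot> p"
proof -
  have "proj_right C (Cod C p) Y \<cdot> \<langle>Id C (Cod C p), f\<rangle> \<cdot> p
      = proj_right C (Cod C p) Y \<cdot> \<langle>Id C (Cod C p), g\<rangle> \<cdot> p"
    using assms(1) by (simp add: as_eq_def)
  moreover have "Y \<in> Obj C"
    using assms Cod_Obj by (auto simp: Hom_iff)
  ultimately show ?thesis
    using assms by (simp add: Hom_iff)
qed

lemma as_eq_postcomp:
  assumes "as_eq C p f g" "p \<in> Arr C" "f \<in> Hom C (Cod C p) Y" "g \<in> Hom C (Cod C p) Y"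
    "h \<in> Arr C" "Dom C h = Y"
  shows "as_eq C p (h \<cdot> f) (h \<cdot> g)"
proof -
  have "(Id C (Cod C p) \<otimes> h) \<cdot> \<langle>Id C (Cod C p), f\<rangle> \<cdot> p = (Id C (Cod C p) \<otimes> h) \<cdot> \<langle>Id C (Cod C p), g\<rangle> \<cdot> p"
    using assms(1) by (simp add: as_eq_def)
  then show ?thesis
    using assms(2-) by (simp add: Hom_iff as_eq_def)
qed

text \<open>Keeping the pair \<open>\<langle>id, a\<rangle>\<close> instead of \<open>a\<close> alone leaves a copy of the sample point available, as
  almost sure equality demands.\<close>

lemma as_eq_pairing_right:
  assumes "as_eq C p f g" "p \<in> Arr C" "f \<in> Hom C (Cod C p) Y" "g \<in> Hom C (Cod C p) Y"
    "a \<in> Hom C (Cod C p) Z"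
  shows "as_eq C p \<langle>a, f\<rangle> \<langle>a, g\<rangle>"
proof -
  let ?A = "Assoc C (Cod C p) Z Y"
  have "\<langle>\<langle>Id C (Cod C p), a\<rangle>, f\<rangle> \<cdot> p = \<langle>\<langle>Id C (Cod C p), a\<rangle>, g\<rangle> \<cdot> p"
    using assms by (intro as_eq_pairing_state[of p f g Y]) (simp_all add: Hom_iff)
  then have "?A \<cdot> \<langle>\<langle>Id C (Cod C p), a\<rangle>, f\<rangle> \<cdot> p = ?A \<cdot> \<langle>\<langle>Id C (Cod C p), a\<rangle>, g\<rangle> \<cdot> p"
    by simp
  moreover have "Y \<in> Obj C" "Z \<in> Obj C"
    using assms Cod_Obj by (auto simp: Hom_iff)
  ultimately show ?thesis
    using assms by (simp add: Hom_iff as_eq_def)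
qed

lemma as_eq_pairing:
  assumes "as_eq C p f f'" "as_eq C p g g'" "p \<in> Arr C"
    "f \<in> Hom C (Cod C p) Y" "f' \<in> Hom C (Cod C p) Y" "g \<in> Hom C (Cod C p) Z" "g' \<in> Hom C (Cod C p) Z"
  shows "as_eq C p \<langle>f, g\<rangle> \<langle>f', g'\<rangle>"
proof -
  have obj: "Y \<in> Obj C" "Z \<in> Obj C"
    using assms Cod_Obj by (auto simp: Hom_iff)
  have "as_eq C p \<langle>g, f\<rangle> \<langle>g, f'\<rangle>"
    using assms by (intro as_eq_pairing_right[of p f f' Y])
  then have "as_eq C p (Swap C Z Y \<cdot> \<langle>g, f\<rangle>) (Swap C Z Y \<cdot> \<langle>g, f'\<rangle>)"
    using assms obj by (intro as_eq_postcomp[where Y = "Z \<boxtimes> Y"]) (simp_all add: Hom_iff)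
  then have "as_eq C p \<langle>f, g\<rangle> \<langle>f', g\<rangle>"
    using assms by (simp add: Hom_iff)
  also have "as_eq C p \<langle>f', g\<rangle> \<langle>f', g'\<rangle>"
    using assms by (intro as_eq_pairing_right[of p g g' Z])
  finally show ?thesis .
qed

lemma as_deterministic_iff:
  "as_deterministic C p f \<longleftrightarrow> as_eq C p (Copy C (Cod C f) \<cdot> f) \<langle>f, f\<rangle>"
  by (simp add: as_deterministic_def pairing_def)

lemma as_deterministic_cong:
  assumes "as_deterministic C p f" "as_eq C p f g" "p \<in> Arr C"
    "f \<in> Hom C (Cod C p) Y" "g \<in> Hom C (Cod C p) Y"
  shows "as_deterministic C p g"
proof -
  have "as_eq C p (Copy C Y \<cdot> g) (Copy C Y \<cdot> f)"
    using assms as_eq_sym[OF assms(2)] Cod_Obj[of f]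
    by (intro as_eq_postcomp[of p g f Y]) (simp_all add: Hom_iff)
  also have "as_eq C p (Copy C Y \<cdot> f) \<langle>f, f\<rangle>"
    using assms by (simp add: as_deterministic_iff Hom_iff)
  also have "as_eq C p \<langle>f, f\<rangle> \<langle>g, g\<rangle>"
    using assms by (intro as_eq_pairing)
  finally show ?thesis
    using assms by (simp add: as_deterministic_iff Hom_iff)
qed

text \<open>The almost sure version of the distributive law of cartesian categories.\<close>

lemma as_deterministic_pairing_comp:
  assumes "as_deterministic C p f" "p \<in> Arr C" "f \<in> Hom C (Cod C p) Y"
    "a \<in> Arr C" "b \<in> Arr C" "Dom C a = Y" "Dom C b = Y"
  shows "as_eq C p (\<langle>a, b\<rangle> \<cdot> f) \<langle>a \<cdot> f, b \<cdot> f\<rangle>"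
proof -
  have Y: "Y \<in> Obj C"
    using assms Cod_Obj by (auto simp: Hom_iff)
  have "as_eq C p ((a \<otimes> b) \<cdot> Copy C Y \<cdot> f) ((a \<otimes> b) \<cdot> \<langle>f, f\<rangle>)"
    using assms Y by (intro as_eq_postcomp[where Y = "Y \<boxtimes> Y"]) (simp_all add: as_deterministic_iff Hom_iff)
  moreover have "(a \<otimes> b) \<cdot> Copy C Y \<cdot> f = \<langle>a, b\<rangle> \<cdot> f"
    using assms Y by (simp add: comp_extend[OF tensor_copy] Hom_iff)
  ultimately show ?thesis
    using assms by (simp add: Hom_iff)
qed

text \<open>Copying \<open>\<langle>f, g\<rangle>\<close> is copying both components and regrouping the four results by the middle swap.\<close>

lemma as_deterministic_pairing:
  assumes "as_deterministic C p f" "as_deterministic C p g" "p \<in> Arr C"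
    "f \<in> Hom C (Cod C p) Y" "g \<in> Hom C (Cod C p) Z"
  shows "as_deterministic C p \<langle>f, g\<rangle>"
proof -
  have obj: "Y \<in> Obj C" "Z \<in> Obj C"
    using assms Cod_Obj by (auto simp: Hom_iff)
  have "as_eq C p \<langle>Copy C Y \<cdot> f, Copy C Z \<cdot> g\<rangle> \<langle>\<langle>f, f\<rangle>, \<langle>g, g\<rangle>\<rangle>"
    using assms obj
    by (intro as_eq_pairing[where Y = "Y \<boxtimes> Y" and Z = "Z \<boxtimes> Z"]) (simp_all add: as_deterministic_iff Hom_iff)
  then have "as_eq C p (mid_swap C Y Y Z Z \<cdot> \<langle>Copy C Y \<cdot> f, Copy C Z \<cdot> g\<rangle>)
      (mid_swap C Y Y Z Z \<cdot> \<langle>\<langle>f, f\<rangle>, \<langle>g, g\<rangle>\<rangle>)"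
    using assms obj
    by (intro as_eq_postcomp[where Y = "(Y \<boxtimes> Y) \<boxtimes> Z \<boxtimes> Z"]) (simp_all add: Hom_iff)
  then show ?thesis
    using assms obj by (simp add: as_deterministic_iff Hom_iff Copy_TensorO)
qed

lemma proj_deterministic:
  assumes "X \<in> Obj C" "Y \<in> Obj C"
  shows "as_deterministic C p (proj_left C X Y)" "as_deterministic C p (proj_right C X Y)"
  using assms by (simp_all add: as_deterministic_iff copy_proj_left copy_proj_right)


section \<open>Disintegrations along deterministic maps\<close>

text \<open>Applying \<open>u\<close> to the first of two independently sampled components involves only the process \<open>a\<close>
  that produces this component.  This is where determinism of the projection enters: \<open>\<langle>id, u\<rangle> \<cdot> \<pi>\<^sub>1\<close>
  may be split into components.\<close>

lemma graph_proj_left: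
  assumes "a \<in> Hom C Z X" "b \<in> Hom C Z Y" "u \<in> Hom C X W"
  shows "\<langle>Id C (X \<boxtimes> Y), u \<cdot> proj_left C X Y\<rangle> \<cdot> \<langle>a, b\<rangle>
    = (inv_arr C (Assoc C X Y W) \<cdot> (Id C X \<otimes> Swap C W Y) \<cdot> Assoc C X W Y) \<cdot> \<langle>\<langle>Id C X, u\<rangle> \<cdot> a, b\<rangle>"
proof -
  let ?p = "proj_left C X Y" and ?q = "proj_right C X Y"
  let ?S = "inv_arr C (Assoc C X Y W) \<cdot> (Id C X \<otimes> Swap C W Y) \<cdot> Assoc C X W Y"
  have obj: "X \<in> Obj C" "Y \<in> Obj C" "Z \<in> Obj C" "W \<in> Obj C"
    using assms Cod_Obj Dom_Obj by (auto simp: Hom_iff)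
  have "\<langle>Id C X, u\<rangle> \<cdot> ?p = (Id C X \<otimes> u) \<cdot> Copy C X \<cdot> ?p"
    using assms obj by (simp add: copy_eq_pairing Hom_iff)
  then have split: "\<langle>Id C X, u\<rangle> \<cdot> ?p = \<langle>?p, u \<cdot> ?p\<rangle>"
    using assms obj by (simp add: copy_proj_left Hom_iff)
  have "\<langle>Id C (X \<boxtimes> Y), u \<cdot> ?p\<rangle> = \<langle>\<langle>?p, ?q\<rangle>, u \<cdot> ?p\<rangle>"
    using obj by (simp add: pairing_proj)
  also have "\<dots> = ?S \<cdot> \<langle>\<langle>Id C X, u\<rangle> \<cdot> ?p, ?q\<rangle>"
    unfolding split using assms obj by (simp add: Hom_iff)
  also have "\<dots> = ?S \<cdot> (\<langle>Id C X, u\<rangle> \<otimes> Id C Y) \<cdot> \<langle>?p, ?q\<rangle>"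
    using assms obj by (simp add: Hom_iff)
  also have "\<dots> = ?S \<cdot> (\<langle>Id C X, u\<rangle> \<otimes> Id C Y)"
    unfolding pairing_proj[OF obj(1,2)] using assms obj by (simp add: Hom_iff)
  finally show ?thesis
    using assms obj by (simp add: Hom_iff)
qed

lemma graph_proj_right:
  assumes "a \<in> Hom C Z X" "b \<in> Hom C Z Y" "v \<in> Hom C Y W"
  shows "\<langle>Id C (X \<boxtimes> Y), v \<cdot> proj_right C X Y\<rangle> \<cdot> \<langle>a, b\<rangle>
    = inv_arr C (Assoc C X Y W) \<cdot> \<langle>a, \<langle>Id C Y, v\<rangle> \<cdot> b\<rangle>"
proof -
  let ?p = "proj_left C X Y" and ?q = "proj_right C X Y"
  let ?S = "inv_arr C (Assoc C X Y W)"
  have obj: "X \<in> Obj C" "Y \<in> Obj C" "Z \<in> Obj C" "W \<in> Obj C"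
    using assms Cod_Obj Dom_Obj by (auto simp: Hom_iff)
  have "\<langle>Id C Y, v\<rangle> \<cdot> ?q = (Id C Y \<otimes> v) \<cdot> Copy C Y \<cdot> ?q"
    using assms obj by (simp add: copy_eq_pairing Hom_iff)
  then have split: "\<langle>Id C Y, v\<rangle> \<cdot> ?q = \<langle>?q, v \<cdot> ?q\<rangle>"
    using assms obj by (simp add: copy_proj_right Hom_iff)
  have "\<langle>Id C (X \<boxtimes> Y), v \<cdot> ?q\<rangle> = \<langle>\<langle>?p, ?q\<rangle>, v \<cdot> ?q\<rangle>"
    using obj by (simp add: pairing_proj)
  also have "\<dots> = ?S \<cdot> \<langle>?p, \<langle>Id C Y, v\<rangle> \<cdot> ?q\<rangle>"
    unfolding split using assms obj by (simp add: Hom_iff)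
  also have "\<dots> = ?S \<cdot> (Id C X \<otimes> \<langle>Id C Y, v\<rangle>) \<cdot> \<langle>?p, ?q\<rangle>"
    using assms obj by (simp add: Hom_iff)
  also have "\<dots> = ?S \<cdot> (Id C X \<otimes> \<langle>Id C Y, v\<rangle>)"
    unfolding pairing_proj[OF obj(1,2)] using assms obj by (simp add: Hom_iff)
  finally show ?thesis
    using assms obj by (simp add: Hom_iff)
qed

text \<open>Both composites recover the point of \<open>Y\<close> at which \<open>a\<close> and \<open>b\<close> were started.  As the right-hand
  sides agree, the two composites are almost surely equal.\<close>

lemma graph_of_disintegrated_pair:
  assumes "q \<in> Arr C" "Cod C q = Y" "a \<in> Hom C Y X\<^sub>1" "b \<in> Hom C Y X\<^sub>2"
    "u \<in> Hom C X\<^sub>1 Y" "v \<in> Hom C X\<^sub>2 Y"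
    "as_eq C q (\<langle>Id C X\<^sub>1, u\<rangle> \<cdot> a) \<langle>a, Id C Y\<rangle>" "as_eq C q (\<langle>Id C X\<^sub>2, v\<rangle> \<cdot> b) \<langle>b, Id C Y\<rangle>"
  shows "\<langle>Id C (X\<^sub>1 \<boxtimes> X\<^sub>2), u \<cdot> proj_left C X\<^sub>1 X\<^sub>2\<rangle> \<cdot> \<langle>a, b\<rangle> \<cdot> q = \<langle>\<langle>a, b\<rangle>, Id C Y\<rangle> \<cdot> q"
    "\<langle>Id C (X\<^sub>1 \<boxtimes> X\<^sub>2), v \<cdot> proj_right C X\<^sub>1 X\<^sub>2\<rangle> \<cdot> \<langle>a, b\<rangle> \<cdot> q = \<langle>\<langle>a, b\<rangle>, Id C Y\<rangle> \<cdot> q"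
proof -
  have obj: "X\<^sub>1 \<in> Obj C" "X\<^sub>2 \<in> Obj C" "Y \<in> Obj C"
    using assms Cod_Obj Dom_Obj by (auto simp: Hom_iff)
  let ?S = "inv_arr C (Assoc C X\<^sub>1 X\<^sub>2 Y) \<cdot> (Id C X\<^sub>1 \<otimes> Swap C Y X\<^sub>2) \<cdot> Assoc C X\<^sub>1 Y X\<^sub>2"
  have 1: "\<langle>\<langle>Id C X\<^sub>1, u\<rangle> \<cdot> a, b\<rangle> \<cdot> q = \<langle>\<langle>a, Id C Y\<rangle>, b\<rangle> \<cdot> q"
    using assms obj by (intro as_eq_state as_eq_pairing) (auto simp: Hom_iff)
  have "\<langle>Id C (X\<^sub>1 \<boxtimes> X\<^sub>2), u \<cdot> proj_left C X\<^sub>1 X\<^sub>2\<rangle> \<cdot> \<langle>a, b\<rangle> \<cdot> q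
      = (?S \<cdot> \<langle>\<langle>Id C X\<^sub>1, u\<rangle> \<cdot> a, b\<rangle>) \<cdot> q"
    using assms(1-6) obj by (intro comp_extend graph_proj_left) (simp_all add: Hom_iff)
  also have "\<dots> = ?S \<cdot> \<langle>\<langle>Id C X\<^sub>1, u\<rangle> \<cdot> a, b\<rangle> \<cdot> q"
    using assms(1-6) obj by (simp add: Hom_iff)
  finally show "\<langle>Id C (X\<^sub>1 \<boxtimes> X\<^sub>2), u \<cdot> proj_left C X\<^sub>1 X\<^sub>2\<rangle> \<cdot> \<langle>a, b\<rangle> \<cdot> q = \<langle>\<langle>a, b\<rangle>, Id C Y\<rangle> \<cdot> q"
    using assms(1-6) obj by (simp add: 1 Hom_iff)
  let ?T = "inv_arr C (Assoc C X\<^sub>1 X\<^sub>2 Y)"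
  have 2: "\<langle>a, \<langle>Id C X\<^sub>2, v\<rangle> \<cdot> b\<rangle> \<cdot> q = \<langle>a, \<langle>b, Id C Y\<rangle>\<rangle> \<cdot> q"
    using assms obj by (intro as_eq_state as_eq_pairing) (auto simp: Hom_iff)
  have "\<langle>Id C (X\<^sub>1 \<boxtimes> X\<^sub>2), v \<cdot> proj_right C X\<^sub>1 X\<^sub>2\<rangle> \<cdot> \<langle>a, b\<rangle> \<cdot> q
      = (?T \<cdot> \<langle>a, \<langle>Id C X\<^sub>2, v\<rangle> \<cdot> b\<rangle>) \<cdot> q"
    using assms(1-6) obj by (intro comp_extend graph_proj_right) (simp_all add: Hom_iff)
  also have "\<dots> = ?T \<cdot> \<langle>a, \<langle>Id C X\<^sub>2, v\<rangle> \<cdot> b\<rangle> \<cdot> q"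
    using assms(1-6) obj by (simp add: Hom_iff)
  finally show "\<langle>Id C (X\<^sub>1 \<boxtimes> X\<^sub>2), v \<cdot> proj_right C X\<^sub>1 X\<^sub>2\<rangle> \<cdot> \<langle>a, b\<rangle> \<cdot> q = \<langle>\<langle>a, b\<rangle>, Id C Y\<rangle> \<cdot> q"
    using assms(1-6) obj by (simp add: 2 Hom_iff)
qed

text \<open>Sampling \<open>y\<close> from \<open>q = u \<cdot> p\<close> and then \<open>x\<close> from \<open>k\<close> at \<open>y\<close> amounts to sampling \<open>x\<close> from \<open>p\<close> and putting
  \<open>y = u x\<close>.  Evaluating \<open>u\<close> once more at \<open>x\<close> gives the same \<open>y\<close> because \<open>u\<close> is almost surely
  deterministic.\<close>

lemma disintegration_fibre:
  assumes "p \<in> Hom C (Unit C) X" "u \<in> Hom C X Y" "k \<in> Hom C Y X"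
    "as_deterministic C p u" "\<langle>Id C X, u\<rangle> \<cdot> p = \<langle>k, Id C Y\<rangle> \<cdot> u \<cdot> p"
  shows "as_eq C (u \<cdot> p) (\<langle>Id C X, u\<rangle> \<cdot> k) \<langle>k, Id C Y\<rangle>"
proof -
  have obj [simp]: "X \<in> Obj C" "Y \<in> Obj C"
    using assms Cod_Obj by (auto simp: Hom_iff)
  have [simp]: "p \<in> Arr C" "Dom C p = Unit C" "Cod C p = X" "u \<in> Arr C" "Dom C u = X" "Cod C u = Y"
    "k \<in> Arr C" "Dom C k = Y" "Cod C k = X"
    using assms by (auto simp: Hom_iff)
  let ?q = "u \<cdot> p"
  \<comment> \<open>Two evaluations of \<open>u\<close> at the same point equal one evaluation followed by copying.\<close>
  have "\<langle>Id C X, \<langle>u, u\<rangle>\<rangle> \<cdot> p = (Id C X \<otimes> Copy C Y) \<cdot> \<langle>Id C X, u\<rangle> \<cdot> p"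
    using assms(4) by (simp add: as_deterministic_iff as_eq_def)
  also have "\<dots> = \<langle>k, \<langle>Id C Y, Id C Y\<rangle>\<rangle> \<cdot> ?q"
    unfolding assms(5) by (simp add: copy_eq_pairing)
  finally have diagonal: "\<langle>Id C X, \<langle>u, u\<rangle>\<rangle> \<cdot> p = \<langle>k, \<langle>Id C Y, Id C Y\<rangle>\<rangle> \<cdot> ?q" .
  let ?S = "Assoc C Y X Y \<cdot> (Swap C X Y \<otimes> Id C Y) \<cdot> inv_arr C (Assoc C X Y Y)"
  have "?S \<cdot> \<langle>Id C X, \<langle>u, u\<rangle>\<rangle> \<cdot> p = ?S \<cdot> \<langle>k, \<langle>Id C Y, Id C Y\<rangle>\<rangle> \<cdot> ?q"
    unfolding diagonal ..
  then have fibre: "\<langle>u, \<langle>Id C X, u\<rangle>\<rangle> \<cdot> p = \<langle>Id C Y, \<langle>k, Id C Y\<rangle>\<rangle> \<cdot> ?q"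
    by simp
  have "Swap C X Y \<cdot> \<langle>k, Id C Y\<rangle> \<cdot> ?q = Swap C X Y \<cdot> \<langle>Id C X, u\<rangle> \<cdot> p"
    unfolding assms(5) ..
  then have inverse: "\<langle>Id C Y, k\<rangle> \<cdot> ?q = \<langle>u, Id C X\<rangle> \<cdot> p"
    by simp
  have "\<langle>Id C Y, \<langle>Id C X, u\<rangle> \<cdot> k\<rangle> \<cdot> ?q = (Id C Y \<otimes> \<langle>Id C X, u\<rangle>) \<cdot> \<langle>Id C Y, k\<rangle> \<cdot> ?q"
    by simp
  also have "\<dots> = \<langle>u, \<langle>Id C X, u\<rangle>\<rangle> \<cdot> p"
    unfolding inverse by simp
  finally show ?thesis
    by (simp add: as_eq_def fibre)
qed

text \<open>For an almost surely deterministic \<open>F\<close> the joint law of \<open>F\<close> and \<open>u \<cdot> F\<close> is the law of the graph of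
  \<open>u\<close> under the image state \<open>F \<cdot> s\<close>, to which the disintegration of that state applies.\<close>

lemma graph_along_deterministic:
  assumes "s \<in> Hom C (Unit C) W" "F \<in> Hom C W X" "as_deterministic C s F" "u \<in> Hom C X Y"
    "\<langle>Id C X, u\<rangle> \<cdot> F \<cdot> s = \<langle>a, Id C Y\<rangle> \<cdot> q"
  shows "\<langle>F, u \<cdot> F\<rangle> \<cdot> s = \<langle>a, Id C Y\<rangle> \<cdot> q"
proof -
  have typing [simp]: "s \<in> Arr C" "Cod C s = W" "F \<in> Arr C" "Dom C F = W" "Cod C F = X"
    "u \<in> Arr C" "Dom C u = X" "Cod C u = Y"
    using assms by (simp_all add: Hom_iff)
  have [simp]: "X \<in> Obj C" "W \<in> Obj C"
    using Dom_Obj[of u] Dom_Obj[of F] by simp_all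
  have "as_eq C s (\<langle>Id C X, u\<rangle> \<cdot> F) \<langle>Id C X \<cdot> F, u \<cdot> F\<rangle>"
    by (rule as_deterministic_pairing_comp[OF assms(3)]) (simp_all add: Hom_iff)
  then have "(\<langle>Id C X, u\<rangle> \<cdot> F) \<cdot> s = \<langle>Id C X \<cdot> F, u \<cdot> F\<rangle> \<cdot> s"
    by (rule as_eq_state[where Y = "X \<boxtimes> Y"]) (simp_all add: Hom_iff)
  then show ?thesis
    using assms(5) by simp
qed

text \<open>Marginalising the independence equation gives \<open>\<langle>\<phi>, id\<rangle> \<cdot> q = \<langle>F, D\<rangle> \<cdot> s = \<langle>a, id\<rangle> \<cdot> q\<close>.  So \<open>\<phi>\<close> and
  \<open>a\<close> are almost surely equal, and so are \<open>\<psi>\<close> and \<open>b\<close>.  In the application \<open>D = u \<cdot> F\<close> and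
  \<open>E = v \<cdot> G\<close>, which represent the same diagonal of the square.\<close>

lemma independent_joint_state:
  assumes "s \<in> Hom C (Unit C) W" "q \<in> Hom C (Unit C) Y"
    "F \<in> Hom C W X\<^sub>1" "G \<in> Hom C W X\<^sub>2" "D \<in> Hom C W Y" "E \<in> Hom C W Y"
    "\<phi> \<in> Hom C Y X\<^sub>1" "\<psi> \<in> Hom C Y X\<^sub>2" "a \<in> Hom C Y X\<^sub>1" "b \<in> Hom C Y X\<^sub>2"
    "as_eq C s D E" "\<langle>F, \<langle>D, G\<rangle>\<rangle> \<cdot> s = \<langle>\<phi>, \<langle>Id C Y, \<psi>\<rangle>\<rangle> \<cdot> q"
    "\<langle>F, D\<rangle> \<cdot> s = \<langle>a, Id C Y\<rangle> \<cdot> q" "\<langle>G, E\<rangle> \<cdot> s = \<langle>b, Id C Y\<rangle> \<cdot> q"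
  shows "\<langle>F, G\<rangle> \<cdot> s = \<langle>a, b\<rangle> \<cdot> q"
proof -
  note joint = assms(12)
  have typing [simp]: "s \<in> Arr C" "Dom C s = Unit C" "Cod C s = W" "q \<in> Arr C" "Dom C q = Unit C" "Cod C q = Y"
    "F \<in> Arr C" "Dom C F = W" "Cod C F = X\<^sub>1" "G \<in> Arr C" "Dom C G = W" "Cod C G = X\<^sub>2"
    "D \<in> Arr C" "Dom C D = W" "Cod C D = Y" "E \<in> Arr C" "Dom C E = W" "Cod C E = Y"
    "\<phi> \<in> Arr C" "Dom C \<phi> = Y" "Cod C \<phi> = X\<^sub>1" "\<psi> \<in> Arr C" "Dom C \<psi> = Y" "Cod C \<psi> = X\<^sub>2"
    "a \<in> Arr C" "Dom C a = Y" "Cod C a = X\<^sub>1" "b \<in> Arr C" "Dom C b = Y" "Cod C b = X\<^sub>2"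
    using assms(1-10) by (simp_all add: Hom_iff)
  have obj [simp]: "X\<^sub>1 \<in> Obj C" "X\<^sub>2 \<in> Obj C" "Y \<in> Obj C"
    using Cod_Obj[of a] Cod_Obj[of b] Dom_Obj[of a] by simp_all
  have phi: "as_eq C q \<phi> a"
  proof -
    have "\<langle>Id C Y, \<phi>\<rangle> \<cdot> q
        = (Swap C X\<^sub>1 Y \<cdot> (Id C X\<^sub>1 \<otimes> proj_left C Y X\<^sub>2)) \<cdot> \<langle>\<phi>, \<langle>Id C Y, \<psi>\<rangle>\<rangle> \<cdot> q"
      by simp
    also have "\<dots> = Swap C X\<^sub>1 Y \<cdot> \<langle>F, D\<rangle> \<cdot> s"
      unfolding joint[symmetric] by simp
    also have "\<dots> = \<langle>Id C Y, a\<rangle> \<cdot> q"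
      unfolding assms(13) by simp
    finally show ?thesis by (simp add: as_eq_def)
  qed
  have psi: "as_eq C q \<psi> b"
  proof -
    have "\<langle>Id C Y, \<psi>\<rangle> \<cdot> q = proj_right C X\<^sub>1 (Y \<boxtimes> X\<^sub>2) \<cdot> \<langle>\<phi>, \<langle>Id C Y, \<psi>\<rangle>\<rangle> \<cdot> q"
      by simp
    also have "\<dots> = Swap C X\<^sub>2 Y \<cdot> \<langle>G, D\<rangle> \<cdot> s"
      unfolding joint[symmetric] by simp
    also have "\<langle>G, D\<rangle> \<cdot> s = \<langle>G, E\<rangle> \<cdot> s"
      by (rule as_eq_pairing_state[OF assms(11), where Y = Y]) (simp_all add: Hom_iff)
    also have "Swap C X\<^sub>2 Y \<cdot> \<dots> = \<langle>Id C Y, b\<rangle> \<cdot> q"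
      unfolding assms(14) by simp
    finally show ?thesis by (simp add: as_eq_def)
  qed
  have "\<langle>F, G\<rangle> \<cdot> s = (Id C X\<^sub>1 \<otimes> proj_right C Y X\<^sub>2) \<cdot> \<langle>F, \<langle>D, G\<rangle>\<rangle> \<cdot> s"
    by simp
  also have "\<dots> = \<langle>\<phi>, \<psi>\<rangle> \<cdot> q"
    unfolding joint by simp
  also have "\<dots> = \<langle>a, b\<rangle> \<cdot> q"
    using phi psi
    by (intro as_eq_state[where Y = "X\<^sub>1 \<boxtimes> X\<^sub>2"] as_eq_pairing[where Y = X\<^sub>1 and Z = X\<^sub>2])
      (simp_all add: Hom_iff)
  finally show ?thesis .
qed

text \<open>Write \<open>k = \<langle>\<pi>\<^sub>1, \<pi>\<^sub>2\<rangle> \<cdot> k\<close> and distribute the pairing over \<open>k\<close>.  For a random \<open>k\<close> this can fail,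
  since its components may be correlated.\<close>

lemma as_deterministic_eq_pairing:
  assumes "s \<in> Arr C" "k \<in> Hom C (Cod C s) (X\<^sub>1 \<boxtimes> X\<^sub>2)" "as_deterministic C s k"
    "F \<in> Hom C (Cod C s) X\<^sub>1" "G \<in> Hom C (Cod C s) X\<^sub>2"
    "as_eq C s (proj_left C X\<^sub>1 X\<^sub>2 \<cdot> k) F" "as_eq C s (proj_right C X\<^sub>1 X\<^sub>2 \<cdot> k) G"
  shows "as_eq C s k \<langle>F, G\<rangle>"
proof -
  let ?p = "proj_left C X\<^sub>1 X\<^sub>2" and ?q = "proj_right C X\<^sub>1 X\<^sub>2"
  have obj [simp]: "X\<^sub>1 \<in> Obj C" "X\<^sub>2 \<in> Obj C"
    using assms Cod_Obj by (auto simp: Hom_iff)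
  have "as_eq C s (\<langle>?p, ?q\<rangle> \<cdot> k) \<langle>?p \<cdot> k, ?q \<cdot> k\<rangle>"
    using assms(1,2)
    by (intro as_deterministic_pairing_comp[OF assms(3), where Y = "X\<^sub>1 \<boxtimes> X\<^sub>2"]) (simp_all add: Hom_iff)
  also have "as_eq C s \<dots> \<langle>F, G\<rangle>"
    using assms by (intro as_eq_pairing[where Y = X\<^sub>1 and Z = X\<^sub>2]) (simp_all add: Hom_iff)
  finally show ?thesis
    using assms(2) by (simp add: pairing_proj Hom_iff)
qed


section \<open>Morphisms of sample spaces through representatives\<close>

lemma as_arr_cong:
  assumes "as_eq C p f g" "f \<in> Hom C X Y" "g \<in> Hom C X Y"
  shows "as_arr C (X, p) B f = as_arr C (X, p) B g"
proof -
  have "as_eq C p f k \<longleftrightarrow> as_eq C p g k" for k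
    using assms(1) by (auto simp: as_eq_def)
  with assms(2,3) show ?thesis
    by (simp add: as_arr_def as_class_def Hom_iff)
qed

lemma as_arr_eqD:
  assumes "as_arr C (X, p) B f = as_arr C (X, p) B g" "f \<in> Hom C X Y"
  shows "as_eq C p f g"
proof -
  have "f \<in> as_class C p f"
    using assms by (auto simp: as_class_def Hom_iff)
  then have "f \<in> as_class C p g"
    using assms by (simp add: as_arr_def)
  then show ?thesis
    by (simp add: as_class_def as_eq_sym)
qed

lemma rep_as_arr:
  assumes "f \<in> Hom C X Y"
  shows "rep (as_arr C (X, p) B f) \<in> Hom C X Y" "as_eq C p f (rep (as_arr C (X, p) B f))"
proof -
  have "f \<in> cls (as_arr C (X, p) B f)"
    using assms by (simp add: as_arr_def as_class_def Hom_iff)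
  then have "rep (as_arr C (X, p) B f) \<in> cls (as_arr C (X, p) B f)"
    unfolding rep_def by (rule someI)
  then show "rep (as_arr C (X, p) B f) \<in> Hom C X Y" "as_eq C p f (rep (as_arr C (X, p) B f))"
    using assms by (auto simp: as_arr_def as_class_def Hom_iff)
qed

lemma Samp_HomI:
  assumes "p \<in> Hom C (Unit C) X" "f \<in> Hom C X Y" "f \<cdot> p = q" "as_deterministic C p f"
  shows "as_arr C (X, p) (Y, q) f \<in> Hom (Samp C) (X, p) (Y, q)"
proof -
  have obj: "X \<in> Obj C" "Y \<in> Obj C" "q \<in> Hom C (Unit C) Y"
    using assms Cod_Obj by (auto simp: Hom_iff)
  have "f \<in> cls (as_arr C (X, p) (Y, q) f)"
    using assms by (simp add: as_arr_def as_class_def Hom_iff)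
  moreover have "src (as_arr C (X, p) (Y, q) f) = (X, p)" "tgt (as_arr C (X, p) (Y, q) f) = (Y, q)"
    by (simp_all add: as_arr_def)
  ultimately show ?thesis
    using assms obj unfolding Samp_def Prob_def Hom_def[of "_\<lparr>Arr := _\<rparr>"] by auto
qed

text \<open>Determinism is assumed of some member of the class; it passes to the chosen representative because
  it is invariant under almost sure equality.\<close>

lemma Samp_HomD:
  assumes "F \<in> Hom (Samp C) (X, p) (Y, q)"
  shows "p \<in> Hom C (Unit C) X" "rep F \<in> Hom C X Y" "rep F \<cdot> p = q" "as_deterministic C p (rep F)"
    "src F = (X, p)" "tgt F = (Y, q)" and as_arr_rep: "as_arr C (X, p) (Y, q) (rep F) = F"
proof -
  obtain f g where f: "p \<in> Hom C (Unit C) X" "f \<in> Hom C X Y" "f \<cdot> p = q" "F = as_arr C (X, p) (Y, q) f"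
    and g: "g \<in> cls F" "as_deterministic C p g"
  proof -
    have F: "F \<in> Arr (Prob C)" "\<exists>g \<in> cls F. as_deterministic C (snd (src F)) g"
      using assms by (simp_all add: Hom_def Samp_def)
    have ends: "src F = (X, p)" "tgt F = (Y, q)"
      using assms by (simp_all add: Hom_def Samp_def Prob_def)
    obtain X' p' Y' q' f where f: "F = as_arr C (X', p') (Y', q') f" "p' \<in> Hom C (Unit C) X'"
      "f \<in> Hom C X' Y'" "f \<cdot> p' = q'"
      using F(1) unfolding Prob_def by (simp only: cat_data.select_convs mem_Collect_eq) blast
    have same: "X' = X" "p' = p" "Y' = Y" "q' = q"
      using ends f(1) by (simp_all add: as_arr_def)
    obtain g where "g \<in> cls F" "as_deterministic C p g"
      using F(2) unfolding ends by (auto simp only: snd_conv)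
    with f[unfolded same] show ?thesis
      by (intro that)
  qed
  have p: "p \<in> Arr C" "Cod C p = X"
    using f by (auto simp: Hom_iff)
  have r: "rep F \<in> Hom C X Y" "as_eq C p f (rep F)"
    using rep_as_arr[OF f(2)] f(4) by auto
  have g': "g \<in> Hom C X Y" "as_eq C p f g"
    using g f by (auto simp: as_arr_def as_class_def Hom_iff)
  have "as_eq C p g (rep F)"
    by (rule as_eq_trans[OF as_eq_sym[OF g'(2)] r(2)])
  then show "as_deterministic C p (rep F)"
    using as_deterministic_cong[OF g(2)] g' r p by simp
  show "rep F \<cdot> p = q"
    using as_eq_state[OF r(2) p(1), of Y] r(1) f(2,3) p(2) by simp
  show "src F = (X, p)" "tgt F = (Y, q)"
    using f(4) by (simp_all add: as_arr_def)
  show "as_arr C (X, p) (Y, q) (rep F) = F"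
    using as_arr_cong[OF r(2) f(2) r(1), symmetric] f(4)[symmetric] by (rule trans)
  show "p \<in> Hom C (Unit C) X" "rep F \<in> Hom C X Y"
    by (fact f(1) r(1))+
qed

lemma Samp_comp: "G \<cdot>\<^bsub>Samp C\<^esub> F = as_arr C (src F) (tgt G) (rep G \<cdot> rep F)"
  by (simp add: Samp_def Prob_def)

lemma tripling_eq_pairing:
  assumes "f \<in> Hom C X A" "g \<in> Hom C X B" "h \<in> Hom C X D"
  shows "tripling C f g h = \<langle>f, \<langle>g, h\<rangle>\<rangle>"
  using assms Dom_Obj[of f] by (auto simp: tripling_def tensor_copy Hom_iff)

text \<open>The definition speaks of a representative of the class of the diagonal.  Since the joint state
  depends only on almost sure equality classes, this representative can be replaced by the
  composite of the representatives of the sides.\<close>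

lemma independent_squareE:
  assumes "independent_square C f g u v" "u \<in> Hom (Samp C) (X, p\<^sub>X) (Z, q)" "v \<in> Hom (Samp C) (Y, p\<^sub>Y) (Z, q)"
  obtains W p \<phi> \<psi> where "f \<in> Hom (Samp C) (W, p) (X, p\<^sub>X)" "g \<in> Hom (Samp C) (W, p) (Y, p\<^sub>Y)"
    "as_eq C p (rep u \<cdot> rep f) (rep v \<cdot> rep g)" "\<phi> \<in> Hom C Z X" "\<psi> \<in> Hom C Z Y"
    "\<langle>rep f, \<langle>rep u \<cdot> rep f, rep g\<rangle>\<rangle> \<cdot> p = \<langle>\<phi>, \<langle>Id C Z, \<psi>\<rangle>\<rangle> \<cdot> q"
proof -
  have "commutative_square (Samp C) f g u v"
    using assms by (simp add: independent_square_def)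
  then obtain W p where f: "f \<in> Hom (Samp C) (W, p) (X, p\<^sub>X)" and g: "g \<in> Hom (Samp C) (W, p) (Y, p\<^sub>Y)"
    and comm: "u \<cdot>\<^bsub>Samp C\<^esub> f = v \<cdot>\<^bsub>Samp C\<^esub> g"
    using assms(2,3) unfolding commutative_square_def Hom_def by fastforce
  note F = Samp_HomD[OF f] and G = Samp_HomD[OF g] and U = Samp_HomD[OF assms(2)] and V = Samp_HomD[OF assms(3)]
  have ends: "src f = (W, p)" "src g = (W, p)" "tgt u = (Z, q)" "tgt v = (Z, q)" "tgt f = (X, p\<^sub>X)" "tgt g = (Y, p\<^sub>Y)"
    by (fact F G U V)+
  have h: "p \<in> Hom C (Unit C) W" "rep f \<in> Hom C W X" "rep g \<in> Hom C W Y" "rep u \<in> Hom C X Z" "rep v \<in> Hom C Y Z"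
    by (fact F G U V)+
  have uf: "rep u \<cdot> rep f \<in> Hom C W Z"
    using h by (auto intro: Comp_Hom)
  have "as_arr C (W, p) (Z, q) (rep u \<cdot> rep f) = as_arr C (W, p) (Z, q) (rep v \<cdot> rep g)"
    using comm by (simp add: Samp_comp ends)
  then have eq: "as_eq C p (rep u \<cdot> rep f) (rep v \<cdot> rep g)"
    by (rule as_arr_eqD) (rule uf)
  define d where "d = rep (u \<cdot>\<^bsub>Samp C\<^esub> f)"
  have d: "d \<in> Hom C W Z" "as_eq C p (rep u \<cdot> rep f) d"
    using rep_as_arr[OF uf] by (auto simp: d_def Samp_comp ends)
  obtain \<phi> \<psi> where phi: "\<phi> \<in> Hom C Z X" "\<psi> \<in> Hom C Z Y"
    "tripling C (rep f) d (rep g) \<cdot> p = tripling C \<phi> (Id C Z) \<psi> \<cdot> q"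
    using assms(1) unfolding independent_square_def Let_def d_def by (auto simp: ends)
  have Z: "Id C Z \<in> Hom C Z Z"
    using uf Cod_Obj by (auto simp: Hom_iff)
  have "\<langle>rep f, \<langle>rep u \<cdot> rep f, rep g\<rangle>\<rangle> \<cdot> p = \<langle>rep f, \<langle>d, rep g\<rangle>\<rangle> \<cdot> p"
    using h uf d by (intro as_eq_state[where Y = "X \<boxtimes> Z \<boxtimes> Y"] as_eq_pairing) (auto simp: Hom_iff)
  also have "\<dots> = \<langle>\<phi>, \<langle>Id C Z, \<psi>\<rangle>\<rangle> \<cdot> q"
    using phi(3) tripling_eq_pairing[OF h(2) d(1) h(3)] tripling_eq_pairing[OF phi(1) Z phi(2)] by simp
  finally show thesis
    using that f g eq phi(1,2) by blast
qed

lemma independent_squareI: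
  assumes "u \<in> Hom (Samp C) (X, p\<^sub>X) (Z, q)" "v \<in> Hom (Samp C) (Y, p\<^sub>Y) (Z, q)"
    "f \<in> Hom (Samp C) (W, p) (X, p\<^sub>X)" "g \<in> Hom (Samp C) (W, p) (Y, p\<^sub>Y)"
    "as_eq C p (rep u \<cdot> rep f) (rep v \<cdot> rep g)" "\<phi> \<in> Hom C Z X" "\<psi> \<in> Hom C Z Y"
    "\<langle>rep f, \<langle>rep u \<cdot> rep f, rep g\<rangle>\<rangle> \<cdot> p = \<langle>\<phi>, \<langle>Id C Z, \<psi>\<rangle>\<rangle> \<cdot> q"
  shows "independent_square C f g u v"
proof -
  note F = Samp_HomD[OF assms(3)] and G = Samp_HomD[OF assms(4)]
    and U = Samp_HomD[OF assms(1)] and V = Samp_HomD[OF assms(2)]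
  have ends: "src f = (W, p)" "src g = (W, p)" "tgt u = (Z, q)" "tgt v = (Z, q)" "tgt f = (X, p\<^sub>X)" "tgt g = (Y, p\<^sub>Y)"
    by (fact F G U V)+
  have h: "p \<in> Hom C (Unit C) W" "rep f \<in> Hom C W X" "rep g \<in> Hom C W Y" "rep u \<in> Hom C X Z" "rep v \<in> Hom C Y Z"
    by (fact F G U V)+
  have uf: "rep u \<cdot> rep f \<in> Hom C W Z" "rep v \<cdot> rep g \<in> Hom C W Z"
    using h by (auto intro: Comp_Hom)
  have "u \<cdot>\<^bsub>Samp C\<^esub> f = v \<cdot>\<^bsub>Samp C\<^esub> g"
    using as_arr_cong[OF assms(5) uf] by (simp add: Samp_comp ends)
  then have comm: "commutative_square (Samp C) f g u v"
    using assms unfolding commutative_square_def by blast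
  define d where "d = rep (u \<cdot>\<^bsub>Samp C\<^esub> f)"
  have d: "d \<in> Hom C W Z" "as_eq C p (rep u \<cdot> rep f) d"
    using rep_as_arr[OF uf(1)] by (auto simp: d_def Samp_comp ends)
  have Z: "Id C Z \<in> Hom C Z Z"
    using uf Cod_Obj by (auto simp: Hom_iff)
  have "\<langle>rep f, \<langle>d, rep g\<rangle>\<rangle> \<cdot> p = \<langle>rep f, \<langle>rep u \<cdot> rep f, rep g\<rangle>\<rangle> \<cdot> p"
    using h uf d as_eq_sym[OF d(2)]
    by (intro as_eq_state[where Y = "X \<boxtimes> Z \<boxtimes> Y"] as_eq_pairing) (auto simp: Hom_iff)
  then have "tripling C (rep f) d (rep g) \<cdot> p = tripling C \<phi> (Id C Z) \<psi> \<cdot> q"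
    using assms(8) tripling_eq_pairing[OF h(2) d(1) h(3)] tripling_eq_pairing[OF assms(6) Z assms(7)] by simp
  then show ?thesis
    using comm assms(6,7) unfolding independent_square_def Let_def d_def by (auto simp: ends)
qed

end


section \<open>Bayesian inverses and the independent pullback\<close>

locale markov_category_with_conditionals = markov_category C
  for C :: "('o, 'm, 'z) markov_data_scheme" (structure) +
  assumes conditionals: "has_conditionals C"
begin

text \<open>Condition the joint state \<open>\<langle>f, id\<rangle> \<cdot> p\<close> on its first component.  The conditional has an additional
  input \<open>I\<close>, which is supplied by \<open>\<langle>id, del\<rangle> : Y \<rightarrow> Y \<boxtimes> I\<close>.\<close>

lemma bayesian_inverse:
  assumes "p \<in> Hom C (Unit C) X" "f \<in> Hom C X Y"
  obtains k where "k \<in> Hom C Y X" "\<langle>Id C X, f\<rangle> \<cdot> p = \<langle>k, Id C Y\<rangle> \<cdot> f \<cdot> p"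
proof -
  let ?I = "Unit C"
  have obj [simp]: "X \<in> Obj C" "Y \<in> Obj C"
    using assms Cod_Obj by (auto simp: Hom_iff)
  have [simp]: "p \<in> Arr C" "Dom C p = ?I" "Cod C p = X" "f \<in> Arr C" "Dom C f = X" "Cod C f = Y"
    using assms by (auto simp: Hom_iff)
  let ?q = "f \<cdot> p" and ?E = "\<langle>Id C Y, Del C Y\<rangle>"
  have joint: "\<langle>f, Id C X\<rangle> \<cdot> p \<in> Hom C ?I (Y \<boxtimes> X)"
    by (simp add: Hom_iff)
  obtain k where k: "k \<in> Hom C (Y \<boxtimes> ?I) X"
    and fk: "\<langle>f, Id C X\<rangle> \<cdot> p = (Id C Y \<otimes> k) \<cdot> Assoc C Y Y ?I \<cdot> (Copy C Y \<otimes> Id C ?I)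
      \<cdot> ((proj_left C Y X \<cdot> \<langle>f, Id C X\<rangle> \<cdot> p) \<otimes> Id C ?I) \<cdot> Copy C ?I"
    using conditionals[unfolded has_conditionals_def, rule_format, OF Unit_Obj obj(2,1) joint] by blast
  have [simp]: "k \<in> Arr C" "Dom C k = Y \<boxtimes> ?I" "Cod C k = X"
    using k by (auto simp: Hom_iff)
  have "Runit C Y \<cdot> \<langle>?q, Id C ?I\<rangle> = Runit C Y \<cdot> ?E \<cdot> ?q"
    by (simp add: runit_pairing comp_extend[OF runit_pairing])
  \<comment> \<open>Both sides agree after the right unitor, which is invertible.\<close>
  then have unit: "\<langle>?q, Id C ?I\<rangle> = ?E \<cdot> ?q"
    using iso_cancel_left[OF Runit_iso[of Y], of "\<langle>?q, Id C ?I\<rangle>" ?I "?E \<cdot> ?q"]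
    by (simp add: Hom_iff)
  have "\<langle>f, Id C X\<rangle> \<cdot> p
      = (Id C Y \<otimes> k) \<cdot> Assoc C Y Y ?I \<cdot> (Copy C Y \<otimes> Id C ?I) \<cdot> (?q \<otimes> Id C ?I) \<cdot> Copy C ?I"
    by (subst fk) simp
  also have "(?q \<otimes> Id C ?I) \<cdot> Copy C ?I = ?E \<cdot> ?q"
    using unit by (simp add: tensor_copy)
  also have "(Id C Y \<otimes> k) \<cdot> Assoc C Y Y ?I \<cdot> (Copy C Y \<otimes> Id C ?I) \<cdot> ?E \<cdot> ?q = \<langle>Id C Y, k \<cdot> ?E\<rangle> \<cdot> ?q"
    by (simp add: copy_eq_pairing)
  finally have "Swap C Y X \<cdot> \<langle>f, Id C X\<rangle> \<cdot> p = Swap C Y X \<cdot> \<langle>Id C Y, k \<cdot> ?E\<rangle> \<cdot> ?q"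
    by simp
  then have "\<langle>Id C X, f\<rangle> \<cdot> p = \<langle>k \<cdot> ?E, Id C Y\<rangle> \<cdot> f \<cdot> p"
    by simp
  moreover have "k \<cdot> ?E \<in> Hom C Y X"
    by (simp add: Hom_iff)
  ultimately show thesis
    using that by blast
qed

text \<open>Representatives can be replaced on the outer side of a composite.  Reading \<open>\<langle>id, f\<rangle> \<cdot> p\<close> as
  \<open>\<langle>k, id\<rangle> \<cdot> f \<cdot> p\<close>, with \<open>k\<close> a Bayesian inverse of \<open>f\<close>, turns almost sure equality with respect to \<open>p\<close>
  into one with respect to \<open>f \<cdot> p\<close>.\<close>

lemma as_eq_precomp:
  assumes "p \<in> Hom C (Unit C) X" "f \<in> Hom C X Y" "g \<in> Hom C Y Z" "h \<in> Hom C Y Z"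
    "as_eq C (f \<cdot> p) g h"
  shows "as_eq C p (g \<cdot> f) (h \<cdot> f)"
proof -
  obtain k where k: "k \<in> Hom C Y X" "\<langle>Id C X, f\<rangle> \<cdot> p = \<langle>k, Id C Y\<rangle> \<cdot> f \<cdot> p"
    using bayesian_inverse assms by blast
  have obj: "X \<in> Obj C" "Y \<in> Obj C" "Z \<in> Obj C"
    using assms Cod_Obj by (auto simp: Hom_iff)
  have graph: "\<langle>Id C X, e \<cdot> f\<rangle> \<cdot> p = \<langle>k, e\<rangle> \<cdot> f \<cdot> p" if "e \<in> Hom C Y Z" for e
  proof -
    have "\<langle>Id C X, e \<cdot> f\<rangle> \<cdot> p = (Id C X \<otimes> e) \<cdot> \<langle>Id C X, f\<rangle> \<cdot> p"
      using that assms(1-4) obj by (simp add: Hom_iff)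
    also have "\<dots> = \<langle>k, e\<rangle> \<cdot> f \<cdot> p"
      unfolding k(2) using that assms(1-4) obj k(1) by (simp add: Hom_iff)
    finally show ?thesis .
  qed
  have "\<langle>k, g\<rangle> \<cdot> f \<cdot> p = \<langle>k, h\<rangle> \<cdot> f \<cdot> p"
    using assms k(1) by (intro as_eq_pairing_state[of _ g h Z]) (auto simp: Hom_iff)
  then show ?thesis
    using assms(1) graph[OF assms(3)] graph[OF assms(4)] by (simp add: as_eq_def Hom_iff)
qed

text \<open>Composition in the category of sample spaces is computed on any representatives, not only on the
  chosen ones.\<close>

lemma Samp_comp_as_arr:
  assumes "p \<in> Hom C (Unit C) X" "f \<in> Hom C X Y" "g \<in> Hom C Y Z"
  shows "as_arr C (Y, f \<cdot> p) D g \<cdot>\<^bsub>Samp C\<^esub> as_arr C (X, p) B f = as_arr C (X, p) D (g \<cdot> f)"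
proof -
  let ?g = "rep (as_arr C (Y, f \<cdot> p) D g)" and ?f = "rep (as_arr C (X, p) B f)"
  have f: "?f \<in> Hom C X Y" "as_eq C p f ?f" and g: "?g \<in> Hom C Y Z" "as_eq C (f \<cdot> p) g ?g"
    using assms by (auto intro: rep_as_arr)
  have p: "p \<in> Arr C" "Cod C p = X"
    using assms by (auto simp: Hom_iff)
  have "as_eq C p (g \<cdot> f) (?g \<cdot> f)"
    using assms g by (intro as_eq_precomp)
  also have "as_eq C p (?g \<cdot> f) (?g \<cdot> ?f)"
    using assms(2) f g(1) p by (intro as_eq_postcomp[of p f ?f Y]) (simp_all add: Hom_iff)
  finally have "as_arr C (X, p) D (g \<cdot> f) = as_arr C (X, p) D (?g \<cdot> ?f)"
    by (rule as_arr_cong) (use assms f g in \<open>auto intro: Comp_Hom\<close>)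
  then show ?thesis
    by (simp add: Samp_comp) (simp add: as_arr_def)
qed

lemma Samp_comp_rep:
  assumes "p \<in> Hom C (Unit C) Y" "h \<in> Hom (Samp C) (X, r) (Y, p)" "g \<in> Hom C Y Z"
  shows "as_arr C (Y, p) D g \<cdot>\<^bsub>Samp C\<^esub> h = as_arr C (X, r) D (g \<cdot> rep h)"
  using Samp_comp_as_arr[OF Samp_HomD(1,2)[OF assms(2)] assms(3), of D "(Y, p)"]
  unfolding Samp_HomD(3)[OF assms(2)] as_arr_rep[OF assms(2)] .

lemma independent_pullback_exists:
  assumes "u \<in> Hom (Samp C) (X\<^sub>1, p\<^sub>1) (Y, q)" "v \<in> Hom (Samp C) (X\<^sub>2, p\<^sub>2) (Y, q)"
  shows "\<exists>\<Omega> f g. f \<in> Hom (Samp C) \<Omega> (X\<^sub>1, p\<^sub>1) \<and> g \<in> Hom (Samp C) \<Omega> (X\<^sub>2, p\<^sub>2) \<and>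
    independent_pullback C f g u v"
proof -
  let ?u = "rep u" and ?v = "rep v"
  note U = Samp_HomD[OF assms(1)] and V = Samp_HomD[OF assms(2)]
  obtain a where a: "a \<in> Hom C Y X\<^sub>1" "\<langle>Id C X\<^sub>1, ?u\<rangle> \<cdot> p\<^sub>1 = \<langle>a, Id C Y\<rangle> \<cdot> q"
    using bayesian_inverse[OF U(1,2)] unfolding U(3) by blast
  obtain b where b: "b \<in> Hom C Y X\<^sub>2" "\<langle>Id C X\<^sub>2, ?v\<rangle> \<cdot> p\<^sub>2 = \<langle>b, Id C Y\<rangle> \<cdot> q"
    using bayesian_inverse[OF V(1,2)] unfolding V(3) by blast
  have obj [simp]: "X\<^sub>1 \<in> Obj C" "X\<^sub>2 \<in> Obj C" "Y \<in> Obj C"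
    using a(1) b(1) Cod_Obj Dom_Obj by (auto simp: Hom_iff)
  have q: "q \<in> Hom C (Unit C) Y"
    using Comp_Hom[OF U(1,2)] unfolding U(3) .
  have typing [simp]: "q \<in> Arr C" "Dom C q = Unit C" "Cod C q = Y"
    "a \<in> Arr C" "Dom C a = Y" "Cod C a = X\<^sub>1" "b \<in> Arr C" "Dom C b = Y" "Cod C b = X\<^sub>2"
    "?u \<in> Arr C" "Dom C ?u = X\<^sub>1" "Cod C ?u = Y" "?v \<in> Arr C" "Dom C ?v = X\<^sub>2" "Cod C ?v = Y"
    "p\<^sub>1 \<in> Arr C" "Dom C p\<^sub>1 = Unit C" "Cod C p\<^sub>1 = X\<^sub>1" "p\<^sub>2 \<in> Arr C" "Dom C p\<^sub>2 = Unit C" "Cod C p\<^sub>2 = X\<^sub>2"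
    using a(1) b(1) q U(1,2) V(1,2) by (simp_all add: Hom_iff)
  have fibre_a: "as_eq C q (\<langle>Id C X\<^sub>1, ?u\<rangle> \<cdot> a) \<langle>a, Id C Y\<rangle>"
    using disintegration_fibre[OF U(1,2) a(1) U(4)] a(2) unfolding U(3) by blast
  have fibre_b: "as_eq C q (\<langle>Id C X\<^sub>2, ?v\<rangle> \<cdot> b) \<langle>b, Id C Y\<rangle>"
    using disintegration_fibre[OF V(1,2) b(1) V(4)] b(2) unfolding V(3) by blast
  \<comment> \<open>The relative product: sample from \<open>q\<close>, then independently from the two fibres.\<close>
  define P where "P = X\<^sub>1 \<boxtimes> X\<^sub>2"
  define r where "r = \<langle>a, b\<rangle> \<cdot> q"
  define \<pi>\<^sub>1 where "\<pi>\<^sub>1 = proj_left C X\<^sub>1 X\<^sub>2"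
  define \<pi>\<^sub>2 where "\<pi>\<^sub>2 = proj_right C X\<^sub>1 X\<^sub>2"
  define f where "f = as_arr C (P, r) (X\<^sub>1, p\<^sub>1) \<pi>\<^sub>1"
  define g where "g = as_arr C (P, r) (X\<^sub>2, p\<^sub>2) \<pi>\<^sub>2"
  have r: "r \<in> Hom C (Unit C) P" and pi1: "\<pi>\<^sub>1 \<in> Hom C P X\<^sub>1" and pi2: "\<pi>\<^sub>2 \<in> Hom C P X\<^sub>2"
    by (simp_all add: r_def P_def \<pi>\<^sub>1_def \<pi>\<^sub>2_def Hom_iff)
  have r': "r \<in> Arr C" "Dom C r = Unit C" "Cod C r = P"
    using r by (simp_all add: Hom_iff)
  have "proj_left C X\<^sub>1 Y \<cdot> \<langle>Id C X\<^sub>1, ?u\<rangle> \<cdot> p\<^sub>1 = proj_left C X\<^sub>1 Y \<cdot> \<langle>a, Id C Y\<rangle> \<cdot> q"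
    unfolding a(2) ..
  then have p1: "a \<cdot> q = p\<^sub>1" by simp
  have "proj_left C X\<^sub>2 Y \<cdot> \<langle>Id C X\<^sub>2, ?v\<rangle> \<cdot> p\<^sub>2 = proj_left C X\<^sub>2 Y \<cdot> \<langle>b, Id C Y\<rangle> \<cdot> q"
    unfolding b(2) ..
  then have p2: "b \<cdot> q = p\<^sub>2" by simp
  have f: "f \<in> Hom (Samp C) (P, r) (X\<^sub>1, p\<^sub>1)"
    unfolding f_def
    by (rule Samp_HomI[OF r pi1]) (simp_all add: \<pi>\<^sub>1_def r_def p1 proj_deterministic)
  have g: "g \<in> Hom (Samp C) (P, r) (X\<^sub>2, p\<^sub>2)"
    unfolding g_def
    by (rule Samp_HomI[OF r pi2]) (simp_all add: \<pi>\<^sub>2_def r_def p2 proj_deterministic)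
  have graph: "\<langle>Id C P, ?u \<cdot> \<pi>\<^sub>1\<rangle> \<cdot> r = \<langle>\<langle>a, b\<rangle>, Id C Y\<rangle> \<cdot> q"
    "\<langle>Id C P, ?v \<cdot> \<pi>\<^sub>2\<rangle> \<cdot> r = \<langle>\<langle>a, b\<rangle>, Id C Y\<rangle> \<cdot> q"
    unfolding P_def \<pi>\<^sub>1_def \<pi>\<^sub>2_def r_def
    by (rule graph_of_disintegrated_pair; use a(1) b(1) U(2) V(2) fibre_a fibre_b in simp)+
  \<comment> \<open>The chosen representatives of the legs are the projections only up to almost sure equality.\<close>
  have rep_f: "rep f \<in> Hom C P X\<^sub>1" "as_eq C r \<pi>\<^sub>1 (rep f)"
    unfolding f_def using rep_as_arr[OF pi1] by blast+
  have rep_g: "rep g \<in> Hom C P X\<^sub>2" "as_eq C r \<pi>\<^sub>2 (rep g)"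
    unfolding g_def using rep_as_arr[OF pi2] by blast+
  have uf: "as_eq C r (?u \<cdot> \<pi>\<^sub>1) (?u \<cdot> rep f)"
    using rep_f pi1 r' by (intro as_eq_postcomp[of r \<pi>\<^sub>1 "rep f" X\<^sub>1]) simp_all
  have vg: "as_eq C r (?v \<cdot> \<pi>\<^sub>2) (?v \<cdot> rep g)"
    using rep_g pi2 r' by (intro as_eq_postcomp[of r \<pi>\<^sub>2 "rep g" X\<^sub>2]) simp_all
  have "as_eq C r (?u \<cdot> \<pi>\<^sub>1) (?v \<cdot> \<pi>\<^sub>2)"
    using graph r' by (simp add: as_eq_def)
  then have commutes: "as_eq C r (?u \<cdot> rep f) (?v \<cdot> rep g)"
    using as_eq_trans[OF as_eq_trans[OF as_eq_sym[OF uf]] vg] by blast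
  have "\<langle>rep f, \<langle>?u \<cdot> rep f, rep g\<rangle>\<rangle> \<cdot> r = \<langle>\<pi>\<^sub>1, \<langle>?u \<cdot> \<pi>\<^sub>1, \<pi>\<^sub>2\<rangle>\<rangle> \<cdot> r"
    using rep_f rep_g uf pi1 pi2 r' as_eq_sym[OF uf] as_eq_sym[OF rep_f(2)] as_eq_sym[OF rep_g(2)]
    by (intro as_eq_state[where Y = "X\<^sub>1 \<boxtimes> Y \<boxtimes> X\<^sub>2"] as_eq_pairing) (simp_all add: Hom_iff)
  also have "\<dots> = (Id C X\<^sub>1 \<otimes> Swap C X\<^sub>2 Y) \<cdot> Assoc C X\<^sub>1 X\<^sub>2 Y \<cdot> \<langle>\<langle>\<pi>\<^sub>1, \<pi>\<^sub>2\<rangle>, ?u \<cdot> \<pi>\<^sub>1\<rangle> \<cdot> r"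
    using pi1 pi2 r' by (simp add: Hom_iff)
  also have "\<langle>\<langle>\<pi>\<^sub>1, \<pi>\<^sub>2\<rangle>, ?u \<cdot> \<pi>\<^sub>1\<rangle> \<cdot> r = \<langle>\<langle>a, b\<rangle>, Id C Y\<rangle> \<cdot> q"
    using graph(1) by (simp add: P_def \<pi>\<^sub>1_def \<pi>\<^sub>2_def pairing_proj)
  also have "(Id C X\<^sub>1 \<otimes> Swap C X\<^sub>2 Y) \<cdot> Assoc C X\<^sub>1 X\<^sub>2 Y \<cdot> \<dots> = \<langle>a, \<langle>Id C Y, b\<rangle>\<rangle> \<cdot> q"
    by simp
  finally have independent: "independent_square C f g u v"
    using independent_squareI[OF assms f g commutes a(1) b(1)] by blast
  have "\<exists>!h. h \<in> Hom (Samp C) (src f') (src f) \<and> f \<cdot>\<^bsub>Samp C\<^esub> h = f' \<and> g \<cdot>\<^bsub>Samp C\<^esub> h = g'"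
    if square: "independent_square C f' g' u v" for f' g'
  proof -
    obtain W s \<phi> \<psi> where f': "f' \<in> Hom (Samp C) (W, s) (X\<^sub>1, p\<^sub>1)"
      and g': "g' \<in> Hom (Samp C) (W, s) (X\<^sub>2, p\<^sub>2)"
      and comm: "as_eq C s (?u \<cdot> rep f') (?v \<cdot> rep g')"
      and phi: "\<phi> \<in> Hom C Y X\<^sub>1" and psi: "\<psi> \<in> Hom C Y X\<^sub>2"
      and joint: "\<langle>rep f', \<langle>?u \<cdot> rep f', rep g'\<rangle>\<rangle> \<cdot> s = \<langle>\<phi>, \<langle>Id C Y, \<psi>\<rangle>\<rangle> \<cdot> q"
      by (rule independent_squareE[OF square assms])
    let ?F = "rep f'" and ?G = "rep g'"
    note F = Samp_HomD[OF f'] and G = Samp_HomD[OF g']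
    have typing' [simp]: "?F \<in> Arr C" "Dom C ?F = W" "Cod C ?F = X\<^sub>1"
      "?G \<in> Arr C" "Dom C ?G = W" "Cod C ?G = X\<^sub>2" "s \<in> Arr C" "Cod C s = W"
      using F(1,2) G(2) by (simp_all add: Hom_iff)
    have comps: "?u \<cdot> ?F \<in> Hom C W Y" "?v \<cdot> ?G \<in> Hom C W Y"
      by (simp_all add: Hom_iff)
    have graph_F: "\<langle>?F, ?u \<cdot> ?F\<rangle> \<cdot> s = \<langle>a, Id C Y\<rangle> \<cdot> q"
      using graph_along_deterministic[OF F(1,2,4) U(2)] a(2) unfolding F(3) by blast
    have graph_G: "\<langle>?G, ?v \<cdot> ?G\<rangle> \<cdot> s = \<langle>b, Id C Y\<rangle> \<cdot> q"
      using graph_along_deterministic[OF G(1,2,4) V(2)] b(2) unfolding G(3) by blast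
    have FG: "\<langle>?F, ?G\<rangle> \<cdot> s = r"
      unfolding r_def
      by (rule independent_joint_state
          [OF F(1) q F(2) G(2) comps phi psi a(1) b(1) comm joint graph_F graph_G])
    have FG_hom: "\<langle>?F, ?G\<rangle> \<in> Hom C W P"
      by (simp add: P_def Hom_iff)
    define h where "h = as_arr C (W, s) (P, r) \<langle>?F, ?G\<rangle>"
    have h: "h \<in> Hom (Samp C) (W, s) (P, r)"
      unfolding h_def
      by (rule Samp_HomI[OF F(1) FG_hom FG], rule as_deterministic_pairing[OF F(4) G(4)])
        (simp_all add: Hom_iff)
    have fh: "f \<cdot>\<^bsub>Samp C\<^esub> h = f'"
      using Samp_comp_as_arr[OF F(1) FG_hom pi1, of "(X\<^sub>1, p\<^sub>1)" "(P, r)"] as_arr_rep[OF f']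
      unfolding FG f_def h_def by (simp add: \<pi>\<^sub>1_def)
    have gh: "g \<cdot>\<^bsub>Samp C\<^esub> h = g'"
      using Samp_comp_as_arr[OF F(1) FG_hom pi2, of "(X\<^sub>2, p\<^sub>2)" "(P, r)"] as_arr_rep[OF g']
      unfolding FG g_def h_def by (simp add: \<pi>\<^sub>2_def)
    have unique: "k = h" if k: "k \<in> Hom (Samp C) (W, s) (P, r)"
      "f \<cdot>\<^bsub>Samp C\<^esub> k = f'" "g \<cdot>\<^bsub>Samp C\<^esub> k = g'" for k
    proof -
      note K = Samp_HomD[OF k(1)]
      have legs: "\<pi>\<^sub>1 \<cdot> rep k \<in> Hom C W X\<^sub>1" "\<pi>\<^sub>2 \<cdot> rep k \<in> Hom C W X\<^sub>2"
        using K(2) pi1 pi2 by (auto intro: Comp_Hom)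
      have "as_arr C (W, s) (X\<^sub>1, p\<^sub>1) (\<pi>\<^sub>1 \<cdot> rep k) = as_arr C (W, s) (X\<^sub>1, p\<^sub>1) ?F"
        using Samp_comp_rep[OF r k(1) pi1, of "(X\<^sub>1, p\<^sub>1)"] k(2) as_arr_rep[OF f']
        unfolding f_def by metis
      then have eq1: "as_eq C s (\<pi>\<^sub>1 \<cdot> rep k) ?F"
        by (rule as_arr_eqD) (rule legs)
      have "as_arr C (W, s) (X\<^sub>2, p\<^sub>2) (\<pi>\<^sub>2 \<cdot> rep k) = as_arr C (W, s) (X\<^sub>2, p\<^sub>2) ?G"
        using Samp_comp_rep[OF r k(1) pi2, of "(X\<^sub>2, p\<^sub>2)"] k(3) as_arr_rep[OF g']
        unfolding g_def by metis
      then have eq2: "as_eq C s (\<pi>\<^sub>2 \<cdot> rep k) ?G"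
        by (rule as_arr_eqD) (rule legs)
      have "as_eq C s (rep k) \<langle>?F, ?G\<rangle>"
        using K(2) F(2) G(2) eq1 eq2
        by (intro as_deterministic_eq_pairing[OF _ _ K(4)]) (simp_all add: \<pi>\<^sub>1_def \<pi>\<^sub>2_def P_def)
      then have "as_arr C (W, s) (P, r) (rep k) = h"
        unfolding h_def by (rule as_arr_cong) (rule K(2) FG_hom)+
      then show ?thesis
        unfolding as_arr_rep[OF k(1)] .
    qed
    show ?thesis
      unfolding F(5) Samp_HomD(5)[OF f] by (rule ex1I[of _ h]) (use h fh gh unique in blast)+
  qed
  then have "independent_pullback C f g u v"
    unfolding independent_pullback_def using independent by blast
  with f g show ?thesis by blast
qed

end

theorem proposition20:
  fixes C :: "('o, 'm, 'z) markov_data_scheme"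
    and X\<^sub>1 X\<^sub>2 Y :: "'o \<times> 'm"
    and u v :: "('o, 'm) prob_arr"
  assumes "markov_category C"
    and "has_conditionals C"
    and "u \<in> Hom (Samp C) X\<^sub>1 Y"
    and "v \<in> Hom (Samp C) X\<^sub>2 Y"
  shows "\<exists>\<Omega> f g. f \<in> Hom (Samp C) \<Omega> X\<^sub>1 \<and> g \<in> Hom (Samp C) \<Omega> X\<^sub>2 \<and>
           independent_pullback C f g u v"
proof -
  interpret markov_category_with_conditionals C
    using assms by (simp add: markov_category_with_conditionals_def markov_category_with_conditionals_axioms_def)
  show ?thesis
    using independent_pullback_exists[of u "fst X\<^sub>1" "snd X\<^sub>1" "fst Y" "snd Y" v "fst X\<^sub>2" "snd X\<^sub>2"] assms
    by simp
qed

end
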